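(* Let $V:\mathbb{Z}^N\to\mathbb{R}$ be a potential on the lattice graph $\mathbb{Z}^N$. Assume there exists a $T$-periodic function $V_p:\mathbb{Z}^N\to\mathbb{R}$ (for some positive integer $T$) such that $$-1<\inf_{x\in\mathbb{Z}^N}V(x)\le V(x)\le V_p(x)\quad\text{for all }x\in\mathbb{Z}^N,$$ and $|V(x)-V_p(x)|\to0$ as $|x|\to+\infty$. Then the problem $$-\Delta u+V(x)u=u\log u^2,\quad x\in\mathbb{Z}^N,$$ has a ground state solution $u$. Moreover, $u(x)>0$ for all $x\in\mathbb{Z}^N$ or $u(x)<0$ for all $x\in\mathbb{Z}^N$.
   Context: The lattice graph $\mathbb{Z}^N$ has vertex set $\mathbb{Z}^N$ and edges $\{x,y\}$ with $\sum_{i=1}^N|x_i-y_i|=1$ (written $x\sim y$). A function $g$ on $\mathbb{Z}^N$ is $T$-periodic if $g(x+Te_i)=g(x)$ for all $x\in\mathbb{Z}^N$, $1\le i\le N$, with $e_i$ the $i$-th unit vector. All functions are real valued, $\mu$ is the counting measure, $\int_{\mathbb{Z}^N}f\,d\mu=\sum_{x}f(x)$, $\Delta u(x)=\sum_{y\sim x}(u(y)-u(x))$, $|\nabla u|^2(x)=\frac12\sum_{y\sim x}(u(y)-u(x))^2$. $H^1(\mathbb{Z}^N)$ is the completion of the finitely supported functions under $\left(\int(|\nabla u|^2+u^2)d\mu\right)^{1/2}$, and $X=\{u\in H^1(\mathbb{Z}^N):\int(V+1)u^2\,d\mu<\infty\}$. The energy $J:X\to(-\infty,+\infty]$ is $$J(u)=\frac12\int_{\mathbb{Z}^N}\left(|\nabla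 u|^2+(V(x)+1)u^2\right)d\mu-\frac12\int_{\mathbb{Z}^N}u^2\log u^2\,d\mu$$ with $0\log 0=0$; $D(J)=\{u\in X:J(u)<+\infty\}$. The Nehari manifold is $$\mathcal{N}=\left\{u\in D(J)\setminus\{0\}:\int_{\mathbb{Z}^N}(|\nabla u|^2+V u^2)\,d\mu=\int_{\mathbb{Z}^N}u^2\log u^2\,d\mu\right\}.$$ A solution is $u\in D(J)$ satisfying the equation at every vertex; a ground state solution is a nontrivial solution $u$ with $J(u)=\inf_{\mathcal{N}}J$. *)

theory Defs
  imports "HOL-Analysis.Analysis"
begin

text \<open>Vertices of the lattice graph are the vectors of type \<open>int ^ 'n\<close>, so that \<open>N = CARD('n)\<close>.\<close>

definition l1_norm :: "int ^ 'n \<Rightarrow> int" where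
  "l1_norm x = (\<Sum>i\<in>UNIV. \<bar>x $ i\<bar>)"

definition adj :: "int ^ 'n \<Rightarrow> int ^ 'n \<Rightarrow> bool"  (infix \<open>\<sim>\<^sub>Z\<close> 50) where
  "x \<sim>\<^sub>Z y \<longleftrightarrow> (\<Sum>i\<in>UNIV. \<bar>x $ i - y $ i\<bar>) = 1"

lemma finite_neighbours: "finite {y. y \<sim>\<^sub>Z (x :: int ^ 'n)}"
proof -
  let ?P = "PiE UNIV (\<lambda>i::'n. {x $ i - 1 .. x $ i + 1})"
  have "{y. y \<sim>\<^sub>Z x} \<subseteq> vec_lambda ` ?P"
  proof
    fix y assume "y \<in> {y. y \<sim>\<^sub>Z x}"
    then have s: "(\<Sum>i\<in>UNIV. \<bar>y $ i - x $ i\<bar>) = 1" by (simp add: adj_def)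
    have "\<bar>y $ i - x $ i\<bar> \<le> 1" for i
      using member_le_sum[of i UNIV "\<lambda>i. \<bar>y $ i - x $ i\<bar>"] s by simp
    then have "vec_nth y \<in> ?P" by (auto simp: abs_le_iff algebra_simps)
    then show "y \<in> vec_lambda ` ?P" by (metis image_eqI vec_nth_inverse)
  qed
  moreover have "finite ?P" by (rule finite_PiE) auto
  ultimately show ?thesis by (meson finite_imageI finite_subset)
qed

definition periodic :: "nat \<Rightarrow> (int ^ 'n \<Rightarrow> real) \<Rightarrow> bool" where
  "periodic T g \<longleftrightarrow> (\<forall>x i. g (x + int T *s axis i 1) = g x)"

definition laplacian :: "(int ^ 'n \<Rightarrow> real) \<Rightarrow> int ^ 'n \<Rightarrow> real" where
  "laplacian u x = (\<Sum>y | y \<sim>\<^sub>Z x. u y - u x)"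

definition grad_sq :: "(int ^ 'n \<Rightarrow> real) \<Rightarrow> int ^ 'n \<Rightarrow> real" where
  "grad_sq u x = 1/2 * (\<Sum>y | y \<sim>\<^sub>Z x. (u y - u x)\<^sup>2)"

definition h1_norm :: "(int ^ 'n \<Rightarrow> real) \<Rightarrow> real" where
  "h1_norm u = sqrt (LINT x|count_space UNIV. grad_sq u x + (u x)\<^sup>2)"

text \<open>The norm dominates the \<open>\<ell>\<^sup>2\<close> norm, so Cauchy sequences of finitely supported functions
  converge pointwise, and the completion is realised as a space of functions: those of finite norm
  that are norm limits of finitely supported ones. The integrability condition expresses finiteness
  of the norm, as the Bochner integral of a non-integrable function is 0.\<close>

definition H1 :: "(int ^ 'n \<Rightarrow> real) set" where
  "H1 = {u. integrable (count_space UNIV) (\<lambda>x. grad_sq u x + (u x)\<^sup>2) \<and>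
     (\<exists>\<phi>. (\<forall>k::nat. finite {x. \<phi> k x \<noteq> 0}) \<and>
          (\<lambda>k. h1_norm (\<lambda>x. u x - \<phi> k x)) \<longlonglongrightarrow> 0)}"

definition X_space :: "(int ^ 'n \<Rightarrow> real) \<Rightarrow> (int ^ 'n \<Rightarrow> real) set" where
  "X_space V = {u \<in> H1. integrable (count_space UNIV) (\<lambda>x. (V x + 1) * (u x)\<^sup>2)}"

text \<open>Integral of the positive part minus integral of the negative part, with values in the
  extended reals; used for functions at least one of whose parts has a finite integral.\<close>

definition ext_integral :: "(int ^ 'n \<Rightarrow> real) \<Rightarrow> ereal" where
  "ext_integral f =
     enn2ereal (\<integral>\<^sup>+x. ennreal (f x) \<partial>count_space UNIV)
   - enn2ereal (\<integral>\<^sup>+x. ennreal (- f x) \<partial>count_space UNIV)"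

text \<open>For \<open>u\<close> in \<open>X_space V\<close> the quadratic terms below are integrable, and \<open>u\<^sup>2 log u\<^sup>2\<close> is positive
  at finitely many vertices only, so its integral is a real number or \<open>-\<infinity>\<close>. The convention
  \<open>0 log 0 = 0\<close> holds by the factor \<open>u\<^sup>2\<close>.\<close>

definition J :: "(int ^ 'n \<Rightarrow> real) \<Rightarrow> (int ^ 'n \<Rightarrow> real) \<Rightarrow> ereal" where
  "J V u =
     ereal (1/2 * (LINT x|count_space UNIV. grad_sq u x + (V x + 1) * (u x)\<^sup>2))
   - ereal (1/2) * ext_integral (\<lambda>x. (u x)\<^sup>2 * ln ((u x)\<^sup>2))"

definition dom_J :: "(int ^ 'n \<Rightarrow> real) \<Rightarrow> (int ^ 'n \<Rightarrow> real) set" where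
  "dom_J V = {u \<in> X_space V. J V u < \<infinity>}"

definition nehari :: "(int ^ 'n \<Rightarrow> real) \<Rightarrow> (int ^ 'n \<Rightarrow> real) set" where
  "nehari V = {u \<in> dom_J V - {\<lambda>x. 0}.
     ereal (LINT x|count_space UNIV. grad_sq u x + V x * (u x)\<^sup>2)
       = ext_integral (\<lambda>x. (u x)\<^sup>2 * ln ((u x)\<^sup>2))}"

definition solution :: "(int ^ 'n \<Rightarrow> real) \<Rightarrow> (int ^ 'n \<Rightarrow> real) \<Rightarrow> bool" where
  "solution V u \<longleftrightarrow> u \<in> dom_J V \<and>
     (\<forall>x. - laplacian u x + V x * u x = u x * ln ((u x)\<^sup>2))"

definition ground_state :: "(int ^ 'n \<Rightarrow> real) \<Rightarrow> (int ^ 'n \<Rightarrow> real) \<Rightarrow> bool" where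
  "ground_state V u \<longleftrightarrow> solution V u \<and> u \<noteq> (\<lambda>x. 0) \<and> J V u = (INF v\<in>nehari V. J V v)"

end

theory Submission
  imports Defs "HOL-Complex_Analysis.Great_Picard" "HOL-Real_Asymp.Real_Asymp"
begin

text \<open>
Write \<open>m\<close> for the infimum of the logarithmic energy
\<open>\<Sum>x. |\<nabla>u|\<^sup>2 + V u\<^sup>2 - u\<^sup>2 ln u\<^sup>2\<close> over the functions with \<open>\<Sum>x. (u x)\<^sup>2 = 1\<close>. Multiplying \<open>u\<close> by \<open>s\<close>
changes the energy to \<open>s\<^sup>2\<close> times itself minus \<open>s\<^sup>2 ln s\<^sup>2\<close> times the mass \<open>\<Sum>x. (u x)\<^sup>2\<close>, so every
nonzero function of finite energy has exactly one positive multiple on the Nehari manifold, where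
the energy is zero. There \<open>J\<close> is half the mass, and its infimum is \<open>exp m / 2\<close>. A ground state is therefore
the same as a minimiser on the unit sphere, scaled to mass \<open>exp m\<close>
(\<open>minimizer_gives_ground_state\<close>).

The point is the existence of a minimiser. On the unit sphere \<open>(u x)\<^sup>2 \<le> 1\<close>, so \<open>- u\<^sup>2 ln u\<^sup>2 \<ge> 0\<close> and
Fatou's lemma applies along a pointwise convergent minimising sequence, unless mass is lost. Mass
cannot be lost partially: cutting a function along a finite set \<open>B\<close> changes the energy only by
products of values across the boundary edges of \<open>B\<close>, whereas two pieces of masses \<open>a\<close> and
\<open>1 - a\<close> have energies at least \<open>a m - a ln a\<close> and \<open>(1 - a) m - (1 - a) ln (1 - a)\<close>, whose
sum exceeds \<open>m\<close> by at least \<open>2 a (1 - a)\<close>. So the pointwise limit is zero or a minimiser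
(\<open>minimizing_limit_dichotomy\<close>).

For the periodic potential the zero limit is excluded by translations: an energy bound gives a lower
bound for the maximum of \<open>u\<^sup>2\<close>, and a period moves the maximum into a finite cell
(\<open>periodic_minimizer\<close>). For \<open>V\<close> itself, a minimising sequence with limit zero has asymptotically the
same energy for \<open>V\<close> and for the periodic potential \<open>Vp \<ge> V\<close>, so that the periodic minimiser is
a minimiser for \<open>V\<close> too (\<open>minimizer_below_potential\<close>).

Finally, \<open>|u|\<close> has at most the energy of \<open>u\<close>. A variation at one vertex gives the Euler--Lagrange
equation with multiplier \<open>m\<close>, by which a zero of a nonnegative minimiser would spread to all
vertices (\<open>euler_lagrange\<close>, \<open>minimizer_pos\<close>).
\<close>

section \<open>Summation over the lattice\<close>

abbreviation \<mu> :: "(int ^ 'n) measure" where "\<mu> \<equiv> count_space UNIV"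

lemma integrable_dominated:
  fixes f g :: "int ^ 'n \<Rightarrow> real"
  assumes "integrable \<mu> g" "\<And>x. \<bar>f x\<bar> \<le> g x"
  shows "integrable \<mu> f"
  by (rule Bochner_Integration.integrable_bound[OF assms(1)])
     (use assms(2) in \<open>auto simp: AE_count_space intro: order_trans[OF _ abs_ge_self]\<close>)

lemma integrable_shift:
  fixes f :: "int ^ 'n \<Rightarrow> real"
  shows "integrable \<mu> (\<lambda>x. f (x + a)) \<longleftrightarrow> integrable \<mu> f"
  by (rule integrable_bij_count_space) (rule bij_betw_byWitness[where f' = "\<lambda>x. x - a"], auto)

lemma integral_shift:
  fixes f :: "int ^ 'n \<Rightarrow> real"
  shows "(LINT x|\<mu>. f (x + a)) = (LINT x|\<mu>. f x)"
  by (rule integral_bij_count_space) (rule bij_betw_byWitness[where f' = "\<lambda>x. x - a"], auto)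

lemma
  fixes f :: "int ^ 'n \<Rightarrow> real"
  assumes "finite B" "\<And>x. x \<notin> B \<Longrightarrow> f x = 0"
  shows integrable_finite_support: "integrable \<mu> f"
    and integral_finite_support: "(LINT x|\<mu>. f x) = sum f B"
proof -
  have fin: "finite {x. f x \<noteq> 0}"
    by (rule finite_subset[OF _ assms(1)]) (use assms(2) in auto)
  have *: "{x \<in> UNIV. f x \<noteq> 0} = {x. f x \<noteq> 0}" by simp
  have nn: "(\<integral>\<^sup>+x. ennreal (norm (f x)) \<partial>\<mu>) = (\<Sum>x | f x \<noteq> 0. ennreal (norm (f x)))"
    using fin by (subst nn_integral_count_space) (auto intro: arg_cong2[where f = sum])
  show "integrable \<mu> f"
    unfolding integrable_iff_bounded nn by (auto simp: sum_ennreal)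
  have "(LINT x|\<mu>. f x) = sum f {x. f x \<noteq> 0}"
    using fin by (subst lebesgue_integral_count_space_finite_support) auto
  also have "\<dots> = sum f B"
    by (rule sum.mono_neutral_left[OF assms(1)]) (use assms(2) in auto)
  finally show "(LINT x|\<mu>. f x) = sum f B" .
qed

lemma sum_le_integral:
  fixes f :: "int ^ 'n \<Rightarrow> real"
  assumes "integrable \<mu> f" "finite B" "\<And>x. f x \<ge> 0"
  shows "sum f B \<le> (LINT x|\<mu>. f x)"
proof -
  have "sum f B = (LINT x|\<mu>. (if x \<in> B then f x else 0))"
    using assms(2) by (subst integral_finite_support[of B]) auto
  also have "\<dots> \<le> (LINT x|\<mu>. f x)"
    by (rule integral_mono[OF integrable_finite_support[of B] assms(1)]) (use assms in auto)
  finally show ?thesis .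
qed

text \<open>Fatou's lemma for the Bochner integral. Integrability of the limit is a conclusion, which the
  logarithmic term of the energy needs: it is not dominated by the mass.\<close>

lemma fatou_bound:
  fixes f :: "nat \<Rightarrow> int ^ 'n \<Rightarrow> real"
  assumes int: "\<And>k. integrable \<mu> (f k)" and nonneg: "\<And>k x. f k x \<ge> 0"
    and lim: "\<And>x. (\<lambda>k. f k x) \<longlonglongrightarrow> g x"
    and bound: "\<And>k. (LINT x|\<mu>. f k x) \<le> c k" and c: "c \<longlonglongrightarrow> b"
  shows "integrable \<mu> g" "(LINT x|\<mu>. g x) \<le> b"
proof -
  have g0: "g x \<ge> 0" for x
    by (rule LIMSEQ_le_const[OF lim]) (use nonneg in auto)
  have c0: "c k \<ge> 0" for k
    using order_trans[OF integral_nonneg_AE bound, of k] nonneg by (auto simp: AE_count_space)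
  have b0: "b \<ge> 0" by (rule LIMSEQ_le_const[OF c]) (use c0 in auto)
  have "(\<integral>\<^sup>+x. ennreal (g x) \<partial>\<mu>) = (\<integral>\<^sup>+x. liminf (\<lambda>k. ennreal (f k x)) \<partial>\<mu>)"
    by (intro nn_integral_cong, rule lim_imp_Liminf[symmetric])
       (auto intro!: tendsto_ennrealI lim)
  also have "\<dots> \<le> liminf (\<lambda>k. \<integral>\<^sup>+x. ennreal (f k x) \<partial>\<mu>)"
    by (rule nn_integral_liminf) auto
  also have "\<dots> \<le> liminf (\<lambda>k. ennreal (c k))"
    using int nonneg bound
    by (intro Liminf_mono always_eventually allI)
       (subst nn_integral_eq_integral, auto simp: AE_count_space intro!: ennreal_leI)
  also have "\<dots> = ennreal b"
    by (rule lim_imp_Liminf) (auto intro!: tendsto_ennrealI c)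
  finally have le: "(\<integral>\<^sup>+x. ennreal (g x) \<partial>\<mu>) \<le> ennreal b" .
  show "integrable \<mu> g"
    using le g0 unfolding integrable_iff_bounded
    by (auto simp: top.not_eq_extremum[symmetric] top_unique)
  then have "ennreal (LINT x|\<mu>. g x) \<le> ennreal b"
    using le g0 by (subst nn_integral_eq_integral[symmetric]) auto
  then show "(LINT x|\<mu>. g x) \<le> b" using b0 by (simp add: ennreal_le_iff)
qed

lemma integral_modify_at:
  fixes f :: "int ^ 'n \<Rightarrow> real"
  assumes "integrable \<mu> f" "\<And>x. x \<noteq> z \<Longrightarrow> g x = f x"
  shows "integrable \<mu> g" "(LINT x|\<mu>. g x) = (LINT x|\<mu>. f x) + (g z - f z)"
proof -
  have eq: "g = (\<lambda>x. f x + (if x = z then g z - f z else 0))" using assms(2) by auto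
  have i: "integrable \<mu> (\<lambda>x. if x = z then g z - f z else 0)"
    by (rule integrable_finite_support[of "{z}"]) auto
  show "integrable \<mu> g" by (subst eq) (intro Bochner_Integration.integrable_add assms i)
  have "(LINT x|\<mu>. g x) = (LINT x|\<mu>. f x) + (LINT x|\<mu>. (if x = z then g z - f z else 0))"
    by (subst eq) (intro Bochner_Integration.integral_add assms i)
  also have "(LINT x|\<mu>. (if x = z then g z - f z else 0)) = g z - f z"
    by (subst integral_finite_support[of "{z}"]) auto
  finally show "(LINT x|\<mu>. g x) = (LINT x|\<mu>. f x) + (g z - f z)" .
qed

section \<open>Square-summable functions and Green's formula\<close>

text \<open>The differences between neighbouring vertices. Indexing the neighbours of \<open>x\<close> as \<open>x + d\<close> lets
  sums over vertices and over neighbours be interchanged.\<close>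

definition steps :: "(int ^ 'n) set" where
  "steps = {d. d \<sim>\<^sub>Z 0}"

lemma finite_steps [simp]: "finite steps"
  unfolding steps_def by (rule finite_neighbours)

lemma adj_iff_steps: "y \<sim>\<^sub>Z x \<longleftrightarrow> y - x \<in> steps"
  by (simp add: adj_def steps_def)

lemma uminus_steps [simp]: "- d \<in> steps \<longleftrightarrow> d \<in> steps"
  by (simp add: adj_def steps_def)

lemma sum_neighbours: "(\<Sum>y | y \<sim>\<^sub>Z x. f y) = (\<Sum>d\<in>steps. f (x + d))"
  by (rule sum.reindex_bij_witness[where i = "\<lambda>d. x + d" and j = "\<lambda>y. y - x"])
     (auto simp: adj_iff_steps)

lemma sum_steps_uminus: "(\<Sum>d\<in>steps. f (- d)) = (\<Sum>d\<in>steps. f d)"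
  by (rule sum.reindex_bij_witness[where i = uminus and j = uminus]) auto

lemma laplacian_steps: "laplacian u x = (\<Sum>d\<in>steps. u (x + d) - u x)"
  unfolding laplacian_def by (rule sum_neighbours)

lemma grad_sq_steps: "grad_sq u x = 1/2 * (\<Sum>d\<in>steps. (u (x + d) - u x)\<^sup>2)"
  unfolding grad_sq_def by (simp only: sum_neighbours[of "\<lambda>y. (u y - u x)\<^sup>2"])

lemma grad_sq_nonneg [simp]: "grad_sq u x \<ge> 0"
  unfolding grad_sq_def by (simp add: sum_nonneg)

definition ell2 :: "(int ^ 'n \<Rightarrow> real) \<Rightarrow> bool" where
  "ell2 u \<longleftrightarrow> integrable \<mu> (\<lambda>x. (u x)\<^sup>2)"

definition mass :: "(int ^ 'n \<Rightarrow> real) \<Rightarrow> real" where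
  "mass u = (LINT x|\<mu>. (u x)\<^sup>2)"

lemma mass_nonneg [simp]: "mass u \<ge> 0"
  unfolding mass_def by simp

lemma integrable_mult_ell2:
  assumes "ell2 u" "ell2 v"
  shows "integrable \<mu> (\<lambda>x. u x * v x)"
proof (rule integrable_dominated)
  show "integrable \<mu> (\<lambda>x. (u x)\<^sup>2 + (v x)\<^sup>2)"
    using assms unfolding ell2_def by simp
  have *: "2 * \<bar>a * b\<bar> \<le> a\<^sup>2 + b\<^sup>2" for a b :: real
    using sum_squares_bound[of "\<bar>a\<bar>" "\<bar>b\<bar>"] by (simp add: abs_mult)
  show "\<bar>u x * v x\<bar> \<le> (u x)\<^sup>2 + (v x)\<^sup>2" for x
    using *[of "u x" "v x"] zero_le_power2[of "u x"] zero_le_power2[of "v x"] by linarith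
qed

lemma ell2_add:
  assumes "ell2 u" "ell2 v"
  shows "ell2 (\<lambda>x. u x + v x)"
proof -
  have "integrable \<mu> (\<lambda>x. (u x)\<^sup>2 + 2 * (u x * v x) + (v x)\<^sup>2)"
    using assms integrable_mult_ell2[OF assms] unfolding ell2_def by simp
  then show ?thesis unfolding ell2_def by (simp add: power2_sum algebra_simps)
qed

lemma ell2_scale: "ell2 u \<Longrightarrow> ell2 (\<lambda>x. c * u x)"
  unfolding ell2_def by (simp add: power_mult_distrib)

lemma ell2_diff: "ell2 u \<Longrightarrow> ell2 v \<Longrightarrow> ell2 (\<lambda>x. u x - v x)"
  using ell2_add[of u "\<lambda>x. - 1 * v x"] ell2_scale[of v "- 1"] by simp

lemma ell2_shift: "ell2 u \<Longrightarrow> ell2 (\<lambda>x. u (x + d))"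
  unfolding ell2_def using integrable_shift[of "\<lambda>x. (u x)\<^sup>2" d] by simp

lemma ell2_dominated:
  assumes "ell2 u" "\<And>x. \<bar>v x\<bar> \<le> \<bar>u x\<bar>"
  shows "ell2 v"
  unfolding ell2_def
  by (rule integrable_dominated[OF assms(1)[unfolded ell2_def]])
     (use assms(2) in \<open>simp add: abs_le_square_iff\<close>)

lemma ell2_finite_support: "finite B \<Longrightarrow> (\<And>x. x \<notin> B \<Longrightarrow> u x = 0) \<Longrightarrow> ell2 u"
  unfolding ell2_def by (rule integrable_finite_support) auto

lemma sq_le_mass: "ell2 u \<Longrightarrow> (u x)\<^sup>2 \<le> mass u"
  using sum_le_integral[of "\<lambda>x. (u x)\<^sup>2" "{x}"] by (simp add: ell2_def mass_def)

lemma mass_eq_0_iff: "ell2 u \<Longrightarrow> mass u = 0 \<longleftrightarrow> u = (\<lambda>x. 0)"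
  using sq_le_mass[of u] by (fastforce simp: mass_def)

lemma mass_scale: "mass (\<lambda>x. c * u x) = c\<^sup>2 * mass u"
  unfolding mass_def by (simp add: power_mult_distrib)

lemma ell2_laplacian: "ell2 u \<Longrightarrow> ell2 (laplacian u)"
proof -
  assume u: "ell2 u"
  have "ell2 (\<lambda>x. \<Sum>d\<in>D. u (x + d) - u x)" if "finite D" for D
    using that
  proof induction
    case empty
    show ?case by (simp add: ell2_def)
  next
    case (insert d D)
    then show ?case using ell2_add[OF ell2_diff[OF ell2_shift[OF u] u]] by simp
  qed
  then show ?thesis by (simp add: laplacian_steps[abs_def])
qed

text \<open>The adjacency relation is symmetric and translation invariant, so a translation in the sum
  moves each step from one factor to the other.\<close>

lemma green_symmetric:
  assumes u: "ell2 u" and v: "ell2 v"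
  shows "(LINT x|\<mu>. u x * laplacian v x) = (LINT x|\<mu>. v x * laplacian u x)"
proof -
  have exp: "(LINT x|\<mu>. a x * laplacian b x)
      = (\<Sum>d\<in>steps. (LINT x|\<mu>. a x * b (x + d)) - (LINT x|\<mu>. a x * b x))"
    if a: "ell2 a" and b: "ell2 b" for a b :: "int ^ 'a \<Rightarrow> real"
  proof -
    note i = integrable_mult_ell2[OF a ell2_shift[OF b]] integrable_mult_ell2[OF a b]
    have "(LINT x|\<mu>. a x * laplacian b x) = (LINT x|\<mu>. (\<Sum>d\<in>steps. a x * b (x + d) - a x * b x))"
      by (simp add: laplacian_steps sum_distrib_left right_diff_distrib)
    also have "\<dots> = (\<Sum>d\<in>steps. LINT x|\<mu>. a x * b (x + d) - a x * b x)"
      by (rule Bochner_Integration.integral_sum) (use i in auto)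
    also have "\<dots> = (\<Sum>d\<in>steps. (LINT x|\<mu>. a x * b (x + d)) - (LINT x|\<mu>. a x * b x))"
      by (intro sum.cong refl Bochner_Integration.integral_diff i)
    finally show ?thesis .
  qed
  have sh: "(LINT x|\<mu>. u x * v (x + d)) = (LINT x|\<mu>. v x * u (x + - d))" for d
    using integral_shift[of "\<lambda>x. u x * v (x + d)" "- d"] by (simp add: mult.commute)
  have "(LINT x|\<mu>. u x * laplacian v x)
      = (\<Sum>d\<in>steps. (\<lambda>d. (LINT x|\<mu>. v x * u (x + d)) - (LINT x|\<mu>. v x * u x)) (- d))"
    by (subst exp[OF u v], intro sum.cong refl, subst sh, simp add: mult.commute)
  also have "\<dots> = (LINT x|\<mu>. v x * laplacian u x)"
    by (subst sum_steps_uminus, subst exp[OF v u]) simp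
  finally show ?thesis .
qed

text \<open>Pointwise, \<open>grad_sq u\<close> is \<open>- u \<cdot> laplacian u\<close> plus half the Laplacian of \<open>u\<^sup>2\<close>, and the sum of
  the latter telescopes to zero.\<close>

lemma
  assumes u: "ell2 u"
  shows integrable_grad_sq: "integrable \<mu> (grad_sq u)"
    and integral_grad_sq: "(LINT x|\<mu>. grad_sq u x) = - (LINT x|\<mu>. u x * laplacian u x)"
proof -
  define w where "w x = (u x)\<^sup>2" for x
  have w: "integrable \<mu> w" using u by (simp add: ell2_def w_def[abs_def])
  have pt: "grad_sq u x = 1/2 * laplacian w x - u x * laplacian u x" for x
    by (simp add: grad_sq_steps laplacian_steps w_def sum_distrib_left flip: sum_subtractf)
       (rule sum.cong, auto simp: power2_eq_square field_simps)
  have iw: "integrable \<mu> (\<lambda>x. w (x + d) - w x)" for d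
    using w integrable_shift[of w d] by simp
  have lw: "integrable \<mu> (laplacian w)"
    unfolding laplacian_steps[abs_def] by (rule Bochner_Integration.integrable_sum) (rule iw)
  have "(LINT x|\<mu>. laplacian w x) = (\<Sum>d\<in>steps. LINT x|\<mu>. w (x + d) - w x)"
    unfolding laplacian_steps by (rule Bochner_Integration.integral_sum) (rule iw)
  also have "\<dots> = 0"
    using w integrable_shift[of w] integral_shift[of w] by simp
  finally have lw0: "(LINT x|\<mu>. laplacian w x) = 0" .
  note ul = integrable_mult_ell2[OF u ell2_laplacian[OF u]]
  show "integrable \<mu> (grad_sq u)"
    unfolding pt[abs_def] using lw ul by simp
  show "(LINT x|\<mu>. grad_sq u x) = - (LINT x|\<mu>. u x * laplacian u x)"
    unfolding pt using lw ul lw0 by simp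
qed

section \<open>The logarithmic energy\<close>

definition sq_log :: "real \<Rightarrow> real" where
  "sq_log s = s\<^sup>2 * ln (s\<^sup>2)"

lemma sq_log_0 [simp]: "sq_log 0 = 0"
  and sq_log_abs [simp]: "sq_log \<bar>s\<bar> = sq_log s"
  by (simp_all add: sq_log_def)

lemma sq_log_mult: "sq_log (c * s) = c\<^sup>2 * sq_log s + s\<^sup>2 * sq_log c"
proof (cases "c = 0 \<or> s = 0")
  case False
  then have "ln (c\<^sup>2 * s\<^sup>2) = ln (c\<^sup>2) + ln (s\<^sup>2)" by (intro ln_mult_pos) auto
  then show ?thesis by (simp add: sq_log_def power_mult_distrib algebra_simps)
qed auto

lemma sq_log_nonpos: "s\<^sup>2 \<le> 1 \<Longrightarrow> sq_log s \<le> 0"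
  by (cases "s = 0") (auto simp: sq_log_def mult_le_0_iff)

lemma sq_log_le: "sq_log s \<le> s\<^sup>2 * s\<^sup>2"
proof (cases "s = 0")
  case False
  then have "ln (s\<^sup>2) \<le> s\<^sup>2 - 1" by (intro ln_le_minus_one) simp
  then have "ln (s\<^sup>2) \<le> s\<^sup>2" by linarith
  then show ?thesis unfolding sq_log_def by (rule mult_left_mono) simp
qed simp

lemma DERIV_sq_log: "(sq_log has_real_derivative 2 * s * ln (s\<^sup>2) + 2 * s) (at s)"
proof (cases "s = 0")
  case False
  have "((\<lambda>s. s\<^sup>2 * ln (s\<^sup>2)) has_real_derivative (s\<^sup>2 * (2 * s / s\<^sup>2) + 2 * s * ln (s\<^sup>2))) (at s)"
    by (rule DERIV_mult'[where f = "\<lambda>s. s\<^sup>2" and g = "\<lambda>s. ln (s\<^sup>2)"])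
       (use False in \<open>auto intro!: derivative_eq_intros\<close>)
  then show ?thesis using False by (simp add: sq_log_def[abs_def] add.commute)
next
  case True
  have "((\<lambda>h::real. h * ln (h\<^sup>2)) \<longlongrightarrow> 0) (at 0)"
    by real_asymp
  moreover have "(sq_log h - sq_log 0) / (h - 0) = h * ln (h\<^sup>2)" for h
    by (simp add: sq_log_def power2_eq_square)
  ultimately show ?thesis
    unfolding True has_field_derivative_iff by simp
qed

lemma isCont_sq_log: "isCont sq_log s"
  using DERIV_sq_log by (rule DERIV_isCont)

text \<open>For a bounded potential these functions form \<open>dom_J\<close>, see \<open>dom_J_iff\<close> below.\<close>

definition log_admissible :: "(int ^ 'n \<Rightarrow> real) \<Rightarrow> bool" where
  "log_admissible u \<longleftrightarrow> ell2 u \<and> integrable \<mu> (\<lambda>x. sq_log (u x))"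

definition log_energy :: "(int ^ 'n \<Rightarrow> real) \<Rightarrow> (int ^ 'n \<Rightarrow> real) \<Rightarrow> real" where
  "log_energy V u = (LINT x|\<mu>. grad_sq u x + V x * (u x)\<^sup>2) - (LINT x|\<mu>. sq_log (u x))"

definition unit_sphere :: "(int ^ 'n \<Rightarrow> real) set" where
  "unit_sphere = {u. log_admissible u \<and> mass u = 1}"

definition min_energy :: "(int ^ 'n \<Rightarrow> real) \<Rightarrow> real" where
  "min_energy V = Inf (log_energy V ` unit_sphere)"

lemma log_admissibleD: "log_admissible u \<Longrightarrow> ell2 u" "log_admissible u \<Longrightarrow> integrable \<mu> (\<lambda>x. sq_log (u x))"
  by (simp_all add: log_admissible_def)

lemma unit_sphereD:
  assumes "u \<in> unit_sphere"
  shows "log_admissible u" "ell2 u" "mass u = 1" "integrable \<mu> (\<lambda>x. sq_log (u x))" "(u x)\<^sup>2 \<le> 1"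
  using assms sq_le_mass[of u x] by (auto simp: unit_sphere_def log_admissible_def)

lemma log_admissible_finite_support: "finite B \<Longrightarrow> (\<And>x. x \<notin> B \<Longrightarrow> u x = 0) \<Longrightarrow> log_admissible u"
  unfolding log_admissible_def by (auto intro!: ell2_finite_support integrable_finite_support[of B])

lemma unit_sphere_nonempty: "unit_sphere \<noteq> {}"
proof -
  let ?e = "\<lambda>x. if x = 0 then 1 else 0 :: real"
  have "mass ?e = 1"
    unfolding mass_def by (subst integral_finite_support[of "{0}"]) auto
  moreover have "log_admissible ?e" by (rule log_admissible_finite_support[of "{0}"]) auto
  ultimately show ?thesis by (auto simp: unit_sphere_def)
qed

locale bounded_potential =
  fixes V :: "int ^ 'n \<Rightarrow> real" and K :: real
  assumes lower: "- 1 \<le> V x" and upper: "V x \<le> K"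
begin

lemma integrable_potential:
  assumes "ell2 u"
  shows "integrable \<mu> (\<lambda>x. V x * (u x)\<^sup>2)"
proof (rule integrable_dominated)
  show "integrable \<mu> (\<lambda>x. (\<bar>K\<bar> + 1) * (u x)\<^sup>2)"
    using assms by (simp add: ell2_def)
  have "\<bar>V x\<bar> \<le> \<bar>K\<bar> + 1" for x using lower[of x] upper[of x] by linarith
  then show "\<bar>V x * (u x)\<^sup>2\<bar> \<le> (\<bar>K\<bar> + 1) * (u x)\<^sup>2" for x
    by (simp add: abs_mult mult_right_mono)
qed

lemma log_energy_green:
  assumes "ell2 u"
  shows "log_energy V u = (LINT x|\<mu>. V x * (u x)\<^sup>2) - (LINT x|\<mu>. u x * laplacian u x)
    - (LINT x|\<mu>. sq_log (u x))"
  unfolding log_energy_def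
  using integrable_grad_sq[OF assms] integrable_potential[OF assms] integral_grad_sq[OF assms]
  by simp

lemma log_energy_scale:
  assumes "log_admissible u"
  shows "log_admissible (\<lambda>x. c * u x)"
    and "log_energy V (\<lambda>x. c * u x) = c\<^sup>2 * log_energy V u - sq_log c * mass u"
proof -
  note u = log_admissibleD[OF assms]
  have sq: "integrable \<mu> (\<lambda>x. (u x)\<^sup>2)" using u(1) by (simp add: ell2_def)
  show "log_admissible (\<lambda>x. c * u x)"
    using u sq unfolding log_admissible_def by (simp add: ell2_scale sq_log_mult)
  have g: "grad_sq (\<lambda>x. c * u x) x + V x * (c * u x)\<^sup>2 = c\<^sup>2 * (grad_sq u x + V x * (u x)\<^sup>2)" for x
    unfolding grad_sq_def right_diff_distrib[symmetric] power_mult_distrib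
      sum_distrib_left[symmetric] by (simp add: distrib_left mult_ac)
  show "log_energy V (\<lambda>x. c * u x) = c\<^sup>2 * log_energy V u - sq_log c * mass u"
    unfolding log_energy_def g mass_def sq_log_mult using u(2) sq
    by (simp add: right_diff_distrib mult.commute)
qed

text \<open>The integrand of energy plus mass. It is nonnegative on the unit sphere: there \<open>(u x)\<^sup>2 \<le> 1\<close>,
  so \<open>- sq_log (u x) \<ge> 0\<close>, and \<open>V + 1 \<ge> 0\<close>. This makes the energy bounded below and accessible to
  Fatou's lemma.\<close>

definition energy_density :: "(int ^ 'n \<Rightarrow> real) \<Rightarrow> int ^ 'n \<Rightarrow> real" where
  "energy_density u x = grad_sq u x + (V x + 1) * (u x)\<^sup>2 - sq_log (u x)"

lemma energy_density_ge: "energy_density u x \<ge> - sq_log (u x)"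
proof -
  have "0 \<le> (V x + 1) * (u x)\<^sup>2" using lower[of x] by simp
  then show ?thesis using grad_sq_nonneg[of u x] unfolding energy_density_def by linarith
qed

lemma
  assumes "u \<in> unit_sphere"
  shows integrable_energy_density: "integrable \<mu> (energy_density u)"
    and integral_energy_density: "(LINT x|\<mu>. energy_density u x) = log_energy V u + 1"
proof -
  note u = unit_sphereD[OF assms]
  have eq: "energy_density u = (\<lambda>x. (grad_sq u x + V x * (u x)\<^sup>2) + (u x)\<^sup>2 - sq_log (u x))"
    by (auto simp: energy_density_def algebra_simps)
  have i: "integrable \<mu> (\<lambda>x. grad_sq u x + V x * (u x)\<^sup>2)" "integrable \<mu> (\<lambda>x. (u x)\<^sup>2)"
    using integrable_grad_sq[OF u(2)] integrable_potential[OF u(2)] u(2) by (simp_all add: ell2_def)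
  show "integrable \<mu> (energy_density u)" unfolding eq using i u(4) by simp
  show "(LINT x|\<mu>. energy_density u x) = log_energy V u + 1"
    unfolding eq using i u(3,4) by (simp add: log_energy_def mass_def)
qed

lemma log_energy_ge_entropy:
  assumes "u \<in> unit_sphere"
  shows "- (LINT x|\<mu>. sq_log (u x)) \<le> log_energy V u + 1"
proof -
  note u = unit_sphereD[OF assms]
  have "- (LINT x|\<mu>. sq_log (u x)) = (LINT x|\<mu>. - sq_log (u x))" by simp
  also have "\<dots> \<le> (LINT x|\<mu>. energy_density u x)"
    using u by (intro integral_mono integrable_energy_density assms energy_density_ge) auto
  finally show ?thesis by (simp add: integral_energy_density[OF assms])
qed

lemma log_energy_ge: "u \<in> unit_sphere \<Longrightarrow> log_energy V u \<ge> - 1"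
proof -
  assume u: "u \<in> unit_sphere"
  have "0 \<le> (LINT x|\<mu>. - sq_log (u x))"
    using unit_sphereD(5)[OF u] by (intro integral_nonneg_AE) (auto simp: AE_count_space sq_log_nonpos)
  then show ?thesis using log_energy_ge_entropy[OF u] by simp
qed

lemma min_energy_le: "u \<in> unit_sphere \<Longrightarrow> min_energy V \<le> log_energy V u"
  unfolding min_energy_def by (rule cINF_lower) (auto intro!: bdd_belowI[of _ "-1"] log_energy_ge)

lemma minimizing_sequence:
  obtains u where "\<And>k. u k \<in> unit_sphere" "(\<lambda>k. log_energy V (u k)) \<longlonglongrightarrow> min_energy V"
proof -
  have "\<exists>u\<in>unit_sphere. log_energy V u < min_energy V + 1 / real (Suc k)" for k
    using cInf_lessD[of "log_energy V ` unit_sphere" "min_energy V + 1 / real (Suc k)"]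
      unit_sphere_nonempty by (auto simp: min_energy_def)
  then obtain u where u: "\<And>k. u k \<in> unit_sphere"
      "\<And>k. log_energy V (u k) < min_energy V + 1 / real (Suc k)" by metis
  have "(\<lambda>k. log_energy V (u k)) \<longlonglongrightarrow> min_energy V"
  proof (rule tendsto_sandwich[OF _ _ tendsto_const])
    show "(\<lambda>k. min_energy V + 1 / real (Suc k)) \<longlonglongrightarrow> min_energy V"
      using tendsto_add[OF tendsto_const LIMSEQ_inverse_real_of_nat, of "min_energy V"]
      by (simp add: inverse_eq_divide)
    show "\<forall>\<^sub>F k in sequentially. min_energy V \<le> log_energy V (u k)"
      using min_energy_le[OF u(1)] by simp
    show "\<forall>\<^sub>F k in sequentially. log_energy V (u k) \<le> min_energy V + 1 / real (Suc k)"
      using u(2) by (intro always_eventually allI less_imp_le)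
  qed
  with u(1) show thesis by (rule that)
qed

text \<open>By scaling, the infimum over the unit sphere bounds the energy of every admissible function. As a function
  of the mass \<open>a\<close>, the bound \<open>a m - a ln a\<close> is strictly concave and zero at \<open>0\<close>, hence strictly
  subadditive: splitting mass into two distant pieces is never optimal.\<close>

lemma log_energy_lower_bound:
  assumes "log_admissible u"
  shows "mass u * min_energy V - mass u * ln (mass u) \<le> log_energy V u"
proof (cases "mass u = 0")
  case True
  then have "u = (\<lambda>x. 0)" using mass_eq_0_iff log_admissibleD(1)[OF assms] by blast
  then show ?thesis by (simp add: log_energy_def mass_def grad_sq_def)
next
  case False
  then have a: "mass u > 0" using mass_nonneg[of u] by linarith
  define s where "s = sqrt (mass u)"
  have s: "s > 0" "s\<^sup>2 = mass u" using a by (simp_all add: s_def)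
  define v where "v x = (1 / s) * u x" for x
  have v: "log_admissible v" unfolding v_def[abs_def] by (rule log_energy_scale(1)[OF assms])
  have mv: "mass v = 1"
    unfolding v_def[abs_def] mass_scale using s a by (simp add: power_divide)
  have uv: "u = (\<lambda>x. s * v x)" using s by (simp add: v_def)
  have "log_energy V u = s\<^sup>2 * log_energy V v - sq_log s * mass v"
    by (subst uv, rule log_energy_scale(2)[OF v])
  moreover have "s\<^sup>2 * min_energy V \<le> s\<^sup>2 * log_energy V v"
    using v mv by (intro mult_left_mono min_energy_le) (auto simp: unit_sphere_def)
  ultimately show ?thesis using s by (simp add: mv sq_log_def)
qed

end

section \<open>Splitting along a finite set\<close>

text \<open>Products across the edges that join \<open>B\<close> and its complement; the sum over all \<open>x\<close> counts each
  such edge twice, once from either end.\<close>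

definition interaction :: "(int ^ 'n) set \<Rightarrow> (int ^ 'n \<Rightarrow> real) \<Rightarrow> int ^ 'n \<Rightarrow> real" where
  "interaction B u x = (\<Sum>d\<in>steps. if x \<in> B \<longleftrightarrow> x + d \<in> B then 0 else u x * u (x + d))"

context bounded_potential
begin

text \<open>Restricting \<open>u\<close> to a set and to its complement gives functions of disjoint support. Hence the
  potential and the logarithmic term are exactly additive, and the gradient term is additive up to
  the products of \<open>u\<close> across the boundary edges.\<close>

lemma log_energy_split:
  fixes B u
  defines "P \<equiv> \<lambda>x. if x \<in> B then u x else 0" and "R \<equiv> \<lambda>x. if x \<in> B then 0 else u x"
  assumes "log_admissible u"
  shows "log_admissible P" "log_admissible R" "mass u = mass P + mass R"
    and "log_energy V u = log_energy V P + log_energy V R - (LINT x|\<mu>. interaction B u x)"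
proof -
  note u = log_admissibleD[OF assms(3)]
  have P2: "ell2 P" and R2: "ell2 R"
    by (rule ell2_dominated[OF u(1)], simp add: P_def R_def)+
  have iP: "integrable \<mu> (\<lambda>x. sq_log (P x))" and iR: "integrable \<mu> (\<lambda>x. sq_log (R x))"
    by (rule integrable_dominated[OF integrable_abs[OF u(2)]], simp add: P_def R_def)+
  show "log_admissible P" "log_admissible R" using P2 R2 iP iR by (simp_all add: log_admissible_def)
  have sq: "(u x)\<^sup>2 = (P x)\<^sup>2 + (R x)\<^sup>2" for x by (simp add: P_def R_def)
  show "mass u = mass P + mass R"
    unfolding mass_def sq using P2 R2 by (simp add: ell2_def)
  have "(LINT x|\<mu>. V x * (u x)\<^sup>2) = (LINT x|\<mu>. V x * (P x)\<^sup>2 + V x * (R x)\<^sup>2)"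
    unfolding sq by (simp add: distrib_left)
  then have pot: "(LINT x|\<mu>. V x * (u x)\<^sup>2) = (LINT x|\<mu>. V x * (P x)\<^sup>2) + (LINT x|\<mu>. V x * (R x)\<^sup>2)"
    using integrable_potential[OF P2] integrable_potential[OF R2] by simp
  have "sq_log (u x) = sq_log (P x) + sq_log (R x)" for x by (simp add: P_def R_def)
  then have log: "(LINT x|\<mu>. sq_log (u x)) = (LINT x|\<mu>. sq_log (P x)) + (LINT x|\<mu>. sq_log (R x))"
    using iP iR by simp
  have pt: "interaction B u x = u x * laplacian u x - P x * laplacian P x - R x * laplacian R x" for x
    unfolding interaction_def laplacian_steps sum_distrib_left sum_subtractf[symmetric]
    by (rule sum.cong) (auto simp: P_def R_def algebra_simps)
  have "(LINT x|\<mu>. interaction B u x) = (LINT x|\<mu>. u x * laplacian u x)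
      - (LINT x|\<mu>. P x * laplacian P x) - (LINT x|\<mu>. R x * laplacian R x)"
    unfolding pt using u(1) P2 R2 by (simp add: integrable_mult_ell2 ell2_laplacian)
  then show "log_energy V u = log_energy V P + log_energy V R - (LINT x|\<mu>. interaction B u x)"
    unfolding log_energy_green[OF u(1)] log_energy_green[OF P2] log_energy_green[OF R2] pot log
    by simp
qed

text \<open>The two pieces have masses \<open>a\<close> and \<open>1 - a\<close>, and the lower bound for their energies exceeds the
  minimal energy by the binary entropy \<open>- a ln a - (1 - a) ln (1 - a)\<close>, which is at least
  \<open>2 a (1 - a)\<close> by \<open>ln t \<le> t - 1\<close>.\<close>

lemma splitting_costs_energy:
  assumes u: "u \<in> unit_sphere" and B: "finite B"
  defines "a \<equiv> \<Sum>x\<in>B. (u x)\<^sup>2"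
  shows "min_energy V + 2 * a * (1 - a) \<le> log_energy V u + (LINT x|\<mu>. interaction B u x)"
proof -
  define P where "P x = (if x \<in> B then u x else 0)" for x
  define R where "R x = (if x \<in> B then 0 else u x)" for x
  note split = log_energy_split[OF unit_sphereD(1)[OF u], of B, folded P_def R_def]
  have mP: "mass P = a"
    unfolding mass_def a_def by (subst integral_finite_support[OF B]) (auto simp: P_def)
  have mR: "mass R = 1 - a" using split(3) unit_sphereD(3)[OF u] mP by simp
  have ent: "b * (1 - b) \<le> - b * ln b" if "b \<ge> 0" for b :: real
  proof (cases "b = 0")
    case False
    then have "b * ln b \<le> b * (b - 1)" using that by (intro mult_left_mono ln_le_minus_one) auto
    then show ?thesis by (simp add: algebra_simps)
  qed simp
  have "a \<ge> 0" "1 - a \<ge> 0" using mass_nonneg[of P] mass_nonneg[of R] mP mR by simp_all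
  from ent[OF this(1)] ent[OF this(2)]
  have "min_energy V + 2 * a * (1 - a) \<le> (a * min_energy V - a * ln a)
      + ((1 - a) * min_energy V - (1 - a) * ln (1 - a))"
    by (simp add: algebra_simps)
  also have "\<dots> \<le> log_energy V P + log_energy V R"
    using log_energy_lower_bound[OF split(1)] log_energy_lower_bound[OF split(2)]
    unfolding mP mR by (rule add_mono)
  finally show ?thesis using split(4) by simp
qed

end

text \<open>Only finitely many edges leave a finite set, so pointwise convergence suffices.\<close>

lemma interaction_tendsto:
  fixes u :: "int ^ 'n \<Rightarrow> real"
  assumes "finite B" "\<And>x. (\<lambda>k. f k x) \<longlonglongrightarrow> u x"
  shows "(\<lambda>k. LINT x|\<mu>. interaction B (f k) x) \<longlonglongrightarrow> (LINT x|\<mu>. interaction B u x)"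
proof -
  let ?B = "B \<union> (\<Union>d\<in>steps. (\<lambda>x. x - d) ` B)"
  have fin: "finite ?B" using assms(1) by auto
  have "interaction B v x = 0" if "x \<notin> ?B" for v x
  proof -
    have "x + d \<notin> B" if "d \<in> steps" for d
    proof
      assume "x + d \<in> B"
      then have "x + d - d \<in> (\<lambda>x. x - d) ` B" by (rule imageI)
      then show False using \<open>x \<notin> ?B\<close> that by auto
    qed
    then show ?thesis using that unfolding interaction_def by (intro sum.neutral) auto
  qed
  then have eq: "(LINT x|\<mu>. interaction B v x) = sum (interaction B v) ?B" for v
    by (rule integral_finite_support[OF fin])
  show ?thesis unfolding eq unfolding interaction_def
    by (rule tendsto_sum)+ (auto intro!: tendsto_mult assms(2))
qed

definition l1_ball :: "nat \<Rightarrow> (int ^ 'n) set" where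
  "l1_ball r = {x. l1_norm x \<le> int r}"

lemma finite_l1_ball: "finite (l1_ball r :: (int ^ 'n) set)"
proof (rule finite_subset)
  have "\<bar>x $ i\<bar> \<le> l1_norm x" for x :: "int ^ 'n" and i
    unfolding l1_norm_def by (rule member_le_sum) auto
  then have "x $ i \<in> {- int r..int r}" if "x \<in> l1_ball r" for x :: "int ^ 'n" and i
    using that unfolding l1_ball_def by (smt (verit) atLeastAtMost_iff mem_Collect_eq)
  then show "l1_ball r \<subseteq> vec_lambda ` (PiE UNIV (\<lambda>i::'n. {- int r..int r}))"
    by (intro subsetI image_eqI[where x = "vec_nth _"]) (auto simp: vec_nth_inverse)
  show "finite (vec_lambda ` (PiE UNIV (\<lambda>i::'n. {- int r..int r})))"
    by (intro finite_imageI finite_PiE) auto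
qed

lemma eventually_in_l1_ball: "\<forall>\<^sub>F r in sequentially. x \<in> l1_ball r"
  using eventually_ge_at_top[of "nat (l1_norm x)"]
  by eventually_elim (simp add: l1_ball_def nat_le_iff)

text \<open>For a fixed function, a large ball carries almost all of the mass and hardly interacts with its
  complement, by dominated convergence.\<close>

lemma mass_exhaustion:
  assumes "ell2 u"
  shows "(\<lambda>r. \<Sum>x\<in>l1_ball r. (u x)\<^sup>2) \<longlonglongrightarrow> mass u"
proof -
  have eq: "(\<Sum>x\<in>l1_ball r. (u x)\<^sup>2) = (LINT x|\<mu>. (if x \<in> l1_ball r then (u x)\<^sup>2 else 0))" for r
    by (subst integral_finite_support[OF finite_l1_ball[of r]]) auto
  show ?thesis unfolding eq mass_def
  proof (rule integral_dominated_convergence[where w = "\<lambda>x. (u x)\<^sup>2"])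
    have "(\<lambda>r. if x \<in> l1_ball r then (u x)\<^sup>2 else 0) \<longlonglongrightarrow> (u x)\<^sup>2" for x
      by (rule tendsto_eventually) (use eventually_in_l1_ball[of x] in eventually_elim, simp)
    then show "AE x in \<mu>. (\<lambda>r. if x \<in> l1_ball r then (u x)\<^sup>2 else 0) \<longlonglongrightarrow> (u x)\<^sup>2" by simp
  qed (use assms in \<open>auto simp: ell2_def\<close>)
qed

lemma interaction_exhaustion:
  fixes u :: "int ^ 'n \<Rightarrow> real"
  assumes "ell2 u"
  shows "(\<lambda>r. LINT x|\<mu>. interaction (l1_ball r) u x) \<longlonglongrightarrow> 0"
proof -
  have "(\<lambda>r. LINT x|\<mu>. interaction (l1_ball r) u x) \<longlonglongrightarrow> (LINT x|(\<mu> :: (int ^ 'n) measure). 0)"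
  proof (rule integral_dominated_convergence[where w = "\<lambda>x. \<Sum>d\<in>steps. \<bar>u x * u (x + d)\<bar>"])
    show "integrable \<mu> (\<lambda>x. \<Sum>d\<in>steps. \<bar>u x * u (x + d)\<bar>)"
      by (intro Bochner_Integration.integrable_sum integrable_abs
          integrable_mult_ell2 ell2_shift assms)
    have "(\<lambda>r. interaction (l1_ball r) u x) \<longlonglongrightarrow> (\<Sum>d\<in>(steps :: (int ^ 'n) set). 0)" for x
      unfolding interaction_def
    proof (rule tendsto_sum)
      fix d
      have "\<forall>\<^sub>F r in sequentially. x \<in> l1_ball r \<and> x + d \<in> l1_ball r"
        by (intro eventually_conj eventually_in_l1_ball)
      then show "(\<lambda>r. if x \<in> l1_ball r \<longleftrightarrow> x + d \<in> l1_ball r then 0 else u x * u (x + d)) \<longlonglongrightarrow> 0"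
        by (intro tendsto_eventually, eventually_elim) simp
    qed
    then show "AE x in \<mu>. (\<lambda>r. interaction (l1_ball r) u x) \<longlonglongrightarrow> 0" by simp
    show "AE x in \<mu>. norm (interaction (l1_ball r) u x) \<le> (\<Sum>d\<in>steps. \<bar>u x * u (x + d)\<bar>)" for r
      unfolding interaction_def by (intro AE_I2 order_trans[OF norm_sum] sum_mono) auto
  qed auto
  then show ?thesis by simp
qed

section \<open>Pointwise limits of minimising sequences\<close>

context bounded_potential
begin

text \<open>A nonzero limit retains all of the mass: a limit of mass strictly between 0 and 1 would split
  the sequence along a large ball into two pieces that hardly interact, which costs energy. Once no
  mass is lost, Fatou's lemma gives minimality.\<close>

proposition minimizing_limit_dichotomy:
  assumes f: "\<And>k. f k \<in> unit_sphere"
    and min: "(\<lambda>k. log_energy V (f k)) \<longlonglongrightarrow> min_energy V"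
    and lim: "\<And>x. (\<lambda>k. f k x) \<longlonglongrightarrow> u x"
  shows "u = (\<lambda>x. 0) \<or> u \<in> unit_sphere \<and> log_energy V u = min_energy V"
proof -
  note fD = unit_sphereD[OF f]
  have "(\<lambda>k. (f k x)\<^sup>2) \<longlonglongrightarrow> (u x)\<^sup>2" for x by (intro tendsto_power lim)
  then have "integrable \<mu> (\<lambda>x. (u x)\<^sup>2) \<and> (LINT x|\<mu>. (u x)\<^sup>2) \<le> 1"
    using fatou_bound[of "\<lambda>k x. (f k x)\<^sup>2" "\<lambda>x. (u x)\<^sup>2" "\<lambda>_. 1" 1] fD(2,3)
    by (simp add: ell2_def mass_def)
  then have u2: "ell2 u" and m1: "mass u \<le> 1" by (simp_all add: ell2_def mass_def)
  \<comment> \<open>The splitting inequality for \<open>f k\<close> passes to the limit first in \<open>k\<close>, along a fixed ball, and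
    then in the radius.\<close>
  have "2 * a * (1 - a) \<le> (LINT x|\<mu>. interaction (l1_ball r) u x)"
    if "a = (\<Sum>x\<in>l1_ball r. (u x)\<^sup>2)" for a r
  proof -
    let ?a = "\<lambda>k. \<Sum>x\<in>l1_ball r. (f k x)\<^sup>2"
    have "?a \<longlonglongrightarrow> a" unfolding that by (intro tendsto_sum tendsto_power lim)
    then have "(\<lambda>k. min_energy V + 2 * ?a k * (1 - ?a k)) \<longlonglongrightarrow> min_energy V + 2 * a * (1 - a)"
      by (intro tendsto_intros)
    moreover have "(\<lambda>k. log_energy V (f k) + (LINT x|\<mu>. interaction (l1_ball r) (f k) x))
        \<longlonglongrightarrow> min_energy V + (LINT x|\<mu>. interaction (l1_ball r) u x)"
      by (intro tendsto_add min interaction_tendsto finite_l1_ball lim)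
    ultimately have "min_energy V + 2 * a * (1 - a) \<le> min_energy V + (LINT x|\<mu>. interaction (l1_ball r) u x)"
      by (rule LIMSEQ_le) (use splitting_costs_energy[OF f finite_l1_ball] in blast)
    then show ?thesis by simp
  qed
  moreover have "(\<lambda>r. 2 * (\<Sum>x\<in>l1_ball r. (u x)\<^sup>2) * (1 - (\<Sum>x\<in>l1_ball r. (u x)\<^sup>2)))
      \<longlonglongrightarrow> 2 * mass u * (1 - mass u)"
    by (intro tendsto_intros mass_exhaustion u2)
  ultimately have "2 * mass u * (1 - mass u) \<le> 0"
    using interaction_exhaustion[OF u2] by (intro LIMSEQ_le[of _ _ _ 0]) auto
  then have "mass u = 0 \<or> mass u = 1"
    using m1 mass_nonneg[of u] by (auto simp: mult_le_0_iff)
  then show ?thesis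
  proof
    assume "mass u = 0"
    then show ?thesis using mass_eq_0_iff[OF u2] by simp
  next
    assume m: "mass u = 1"
    have e: "(\<lambda>k. energy_density (f k) x) \<longlonglongrightarrow> energy_density u x" for x
      unfolding energy_density_def grad_sq_def
      by (intro tendsto_intros lim isCont_tendsto_compose[OF isCont_sq_log])
    have nn: "energy_density (f k) x \<ge> 0" for k x
      using energy_density_ge[of "f k" x] sq_log_nonpos[OF fD(5)[of k x]] by linarith
    note fatou = fatou_bound[OF integrable_energy_density[OF f] nn e
        eq_refl[OF integral_energy_density[OF f]] tendsto_add[OF min tendsto_const[of 1]]]
    have "sq_log (u x) = grad_sq u x + V x * (u x)\<^sup>2 + (u x)\<^sup>2 - energy_density u x" for x
      by (simp add: energy_density_def algebra_simps)
    then have "integrable \<mu> (\<lambda>x. sq_log (u x))"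
      using fatou(1) integrable_grad_sq[OF u2] integrable_potential[OF u2] u2
      by (simp add: ell2_def)
    then have us: "u \<in> unit_sphere" using u2 m by (simp add: unit_sphere_def log_admissible_def)
    then have "log_energy V u = min_energy V"
      using fatou(2) min_energy_le[OF us] by (simp add: integral_energy_density)
    with us show ?thesis by simp
  qed
qed

lemma unit_sphere_convergent_subsequence:
  fixes f :: "nat \<Rightarrow> int ^ 'n \<Rightarrow> real"
  assumes f: "\<And>k. f k \<in> unit_sphere"
  obtains r u where "strict_mono (r :: nat \<Rightarrow> nat)" "\<And>x. (\<lambda>k. f (r k) x) \<longlonglongrightarrow> u x"
proof -
  have "norm (f k x) \<le> 1" for k x
    using unit_sphereD(5)[OF f, of k x] by (simp add: abs_square_le_1)
  then obtain r :: "nat \<Rightarrow> nat" where r: "strict_mono r" "\<And>x. \<exists>l. (\<lambda>k. f (r k) x) \<longlonglongrightarrow> l"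
    using function_convergent_subsequence[of UNIV f 1] by (metis UNIV_I countableI_type)
  then show thesis using that by metis
qed

end

section \<open>Existence of minimisers\<close>

text \<open>The coordinate directions generate the lattice. Multiples of \<open>c\<close> are used with the period for
  \<open>periodic_translate\<close>, and with \<open>c = 1\<close> for the connectedness of the lattice graph.\<close>

lemma lattice_induct:
  fixes P :: "int ^ 'n \<Rightarrow> bool"
  assumes up: "\<And>y i. P y \<Longrightarrow> P (y + c *s axis i 1)"
    and down: "\<And>y i. P y \<Longrightarrow> P (y - c *s axis i 1)"
    and base: "P x"
  shows "P (x + c *s k)"
proof -
  have line: "P (y + n *s (c *s axis i 1))" if "P y" for y i and n :: int
  proof (induction n rule: int_induct[where k = 0])
    case base
    then show ?case using that by simp
  next
    case (step1 n)
    have eq: "y + (n + 1) *s (c *s axis i 1) = y + n *s (c *s axis i 1) + c *s axis i 1"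
      by (simp add: vec_eq_iff algebra_simps)
    show ?case unfolding eq by (rule up[OF step1(2)])
  next
    case (step2 n)
    have eq: "y + (n - 1) *s (c *s axis i 1) = y + n *s (c *s axis i 1) - c *s axis i 1"
      by (simp add: vec_eq_iff algebra_simps)
    show ?case unfolding eq by (rule down[OF step2(2)])
  qed
  have "P (x + (\<Sum>i\<in>S. k $ i *s (c *s axis i 1)))" if "finite S" for S
    using that
  proof induction
    case empty
    show ?case using base by simp
  next
    case (insert i S)
    have "x + (\<Sum>j\<in>insert i S. k $ j *s (c *s axis j 1))
        = x + (\<Sum>j\<in>S. k $ j *s (c *s axis j 1)) + k $ i *s (c *s axis i 1)"
      using insert.hyps by (simp add: add_ac)
    then show ?case using line[OF insert.IH, of "k $ i" i] by (simp only:)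
  qed
  from this[of UNIV] have "P (x + (\<Sum>i\<in>UNIV. k $ i *s (c *s axis i 1)))" by simp
  moreover have "(\<Sum>i\<in>UNIV. k $ i *s (c *s axis i 1)) = c *s (\<Sum>i\<in>UNIV. k $ i *s axis i 1)"
    by (simp add: vec_eq_iff sum_distrib_left mult_ac)
  ultimately show ?thesis by (simp add: basis_expansion)
qed

lemma periodic_translate:
  assumes "periodic T V"
  shows "V (x + int T *s k) = V x"
proof (rule lattice_induct)
  fix y i
  assume y: "V y = V x"
  show "V (y + int T *s axis i 1) = V x" using assms y by (simp add: periodic_def)
  have "V (y - int T *s axis i 1 + int T *s axis i 1) = V (y - int T *s axis i 1)"
    using assms unfolding periodic_def by blast
  then show "V (y - int T *s axis i 1) = V x" using y by simp
qed simp

definition period_cell :: "nat \<Rightarrow> (int ^ 'n) set" where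
  "period_cell T = {x. \<forall>i. x $ i \<in> {0..<int T}}"

lemma finite_period_cell: "finite (period_cell T :: (int ^ 'n) set)"
proof (rule finite_subset)
  show "period_cell T \<subseteq> vec_lambda ` (PiE UNIV (\<lambda>i::'n. {0..<int T}))"
    by (intro subsetI image_eqI[where x = "vec_nth _"]) (auto simp: vec_nth_inverse period_cell_def)
  show "finite (vec_lambda ` (PiE UNIV (\<lambda>i::'n. {0..<int T})))"
    by (intro finite_imageI finite_PiE) auto
qed

lemma translate_into_period_cell:
  fixes x :: "int ^ 'n"
  assumes "T > 0"
  obtains y k where "y \<in> period_cell T" "x = y + int T *s k"
proof
  show "(\<chi> i. x $ i mod int T) \<in> period_cell T" using assms by (simp add: period_cell_def)
  show "x = (\<chi> i. x $ i mod int T) + int T *s (\<chi> i. x $ i div int T)"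
    by (simp add: vec_eq_iff)
qed

context bounded_potential
begin

text \<open>If all values \<open>(u x)\<^sup>2\<close> are at most \<open>exp (- c)\<close>, then \<open>- ln ((u x)\<^sup>2) \<ge> c\<close> where \<open>u x \<noteq> 0\<close>, and the
  energy is at least \<open>c - 1\<close>.\<close>

lemma nonvanishing:
  assumes "u \<in> unit_sphere"
  shows "\<exists>x. exp (- (log_energy V u + 2)) < (u x)\<^sup>2"
proof (rule ccontr)
  define c where "c = log_energy V u + 2"
  assume "\<not> ?thesis"
  then have small: "(u x)\<^sup>2 \<le> exp (- c)" for x by (simp add: c_def not_less)
  note u = unit_sphereD[OF assms]
  have pt: "c * (u x)\<^sup>2 \<le> - sq_log (u x)" for x
  proof (cases "u x = 0")
    case False
    then have "ln ((u x)\<^sup>2) \<le> ln (exp (- c))" using small[of x] by (subst ln_le_cancel_iff) auto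
    then have "ln ((u x)\<^sup>2) \<le> - c" by simp
    then have "(u x)\<^sup>2 * ln ((u x)\<^sup>2) \<le> (u x)\<^sup>2 * - c" by (rule mult_left_mono) simp
    then show ?thesis by (simp add: sq_log_def mult.commute)
  qed simp
  have "c = (LINT x|\<mu>. c * (u x)\<^sup>2)" using u(3) by (simp add: mass_def)
  also have "\<dots> \<le> (LINT x|\<mu>. - sq_log (u x))"
    using u(2,4) pt by (intro integral_mono) (auto simp: ell2_def)
  also have "\<dots> \<le> c - 1" using log_energy_ge_entropy[OF assms] by (simp add: c_def)
  finally show False by simp
qed

lemma translate_unit_sphere:
  assumes "u \<in> unit_sphere" "\<And>x. V (x + a) = V x"
  shows "(\<lambda>x. u (x + a)) \<in> unit_sphere" "log_energy V (\<lambda>x. u (x + a)) = log_energy V u"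
proof -
  note u = unit_sphereD[OF assms(1)]
  have g: "grad_sq (\<lambda>x. u (x + a)) x = grad_sq u (x + a)" for x
    by (simp add: grad_sq_steps add_ac)
  show "(\<lambda>x. u (x + a)) \<in> unit_sphere"
    using u integrable_shift[of "\<lambda>x. sq_log (u x)" a] integral_shift[of "\<lambda>x. (u x)\<^sup>2" a]
    by (simp add: unit_sphere_def log_admissible_def ell2_shift mass_def)
  show "log_energy V (\<lambda>x. u (x + a)) = log_energy V u"
    using integral_shift[of "\<lambda>x. grad_sq u x + V x * (u x)\<^sup>2" a] integral_shift[of "\<lambda>x. sq_log (u x)" a]
    by (simp add: log_energy_def g assms(2))
qed

text \<open>Translating each member of a minimising sequence by a period brings a point where it is not
  small into the fundamental cell. As the cell is finite, the pointwise limit does not vanish.\<close>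

proposition periodic_minimizer:
  assumes per: "periodic T V" and T: "T > 0"
  obtains u where "u \<in> unit_sphere" "log_energy V u = min_energy V"
proof -
  obtain f where f: "\<And>k. f k \<in> unit_sphere" "(\<lambda>k. log_energy V (f k)) \<longlonglongrightarrow> min_energy V"
    by (rule minimizing_sequence) blast
  obtain C where C: "\<And>k. log_energy V (f k) \<le> C"
  proof -
    have "Bseq (\<lambda>k. log_energy V (f k))" using f(2) by (intro convergent_imp_Bseq) (auto simp: convergent_def)
    then obtain C where "\<And>k. norm (log_energy V (f k)) \<le> C" by (auto simp: Bseq_def)
    then show thesis by (intro that[of C]) (simp add: abs_le_iff)
  qed
  define \<delta> where "\<delta> = exp (- (C + 2))"
  have "\<exists>a y. y \<in> period_cell T \<and> \<delta> < (f k (y + int T *s a))\<^sup>2" for k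
  proof -
    obtain x where x: "exp (- (log_energy V (f k) + 2)) < (f k x)\<^sup>2" using nonvanishing[OF f(1)] by blast
    have "\<delta> \<le> exp (- (log_energy V (f k) + 2))" using C[of k] by (simp add: \<delta>_def)
    then have "\<delta> < (f k x)\<^sup>2" using x by simp
    moreover obtain y a where "y \<in> period_cell T" "x = y + int T *s a"
      using translate_into_period_cell[OF T] by blast
    ultimately show ?thesis by blast
  qed
  then obtain a y where y: "\<And>k. y k \<in> period_cell T" "\<And>k. \<delta> < (f k (y k + int T *s a k))\<^sup>2" by metis
  define g where "g k x = f k (x + int T *s a k)" for k x
  have g: "g k \<in> unit_sphere" "log_energy V (g k) = log_energy V (f k)" for k
    using translate_unit_sphere[OF f(1) periodic_translate[OF per]] by (simp_all add: g_def[abs_def])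
  obtain r u where r: "strict_mono (r :: nat \<Rightarrow> nat)" and u: "\<And>x. (\<lambda>k. g (r k) x) \<longlonglongrightarrow> u x"
    by (rule unit_sphere_convergent_subsequence[OF g(1)]) (rule that)
  have "(\<lambda>k. log_energy V (g (r k))) \<longlonglongrightarrow> min_energy V"
    using LIMSEQ_subseq_LIMSEQ[OF f(2) r] by (simp add: g(2) o_def)
  from minimizing_limit_dichotomy[OF g(1) this u]
  have "u = (\<lambda>x. 0) \<or> u \<in> unit_sphere \<and> log_energy V u = min_energy V" .
  moreover have "u \<noteq> (\<lambda>x. 0)"
  proof
    assume u0: "u = (\<lambda>x. 0)"
    have "\<delta> \<le> (\<Sum>x\<in>period_cell T. (g (r k) x)\<^sup>2)" for k
      using y[of "r k"] member_le_sum[OF y(1)[of "r k"], of "\<lambda>x. (g (r k) x)\<^sup>2"]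
      by (simp add: g_def finite_period_cell)
    moreover have "(\<lambda>k. \<Sum>x\<in>period_cell T. (g (r k) x)\<^sup>2) \<longlonglongrightarrow> (\<Sum>x\<in>period_cell T. (u x)\<^sup>2)"
      by (intro tendsto_sum tendsto_power u)
    ultimately have "\<delta> \<le> (\<Sum>x\<in>period_cell T. (u x)\<^sup>2)" by (intro LIMSEQ_le_const) auto
    then show False by (simp add: u0 \<delta>_def)
  qed
  ultimately show thesis using that by blast
qed

end

text \<open>If the minimising sequence for \<open>V\<close> vanishes in the limit, it does not see the difference
  \<open>Vp - V\<close>. So the minimal energy for \<open>V\<close> is at least that for \<open>Vp\<close>, and a minimiser for \<open>Vp\<close>, whose
  energy can only drop when \<open>Vp\<close> is replaced by the smaller \<open>V\<close>, is a minimiser for \<open>V\<close>.\<close>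

proposition minimizer_below_potential:
  fixes V Vp :: "int ^ 'n \<Rightarrow> real"
  assumes "bounded_potential V K" "bounded_potential Vp K'"
    and le: "\<And>x. V x \<le> Vp x"
    and decay: "\<And>\<epsilon>. \<epsilon> > 0 \<Longrightarrow> \<exists>B. finite B \<and> (\<forall>x. x \<notin> B \<longrightarrow> Vp x - V x \<le> \<epsilon>)"
    and w: "w \<in> unit_sphere" "log_energy Vp w = min_energy Vp"
  obtains u where "u \<in> unit_sphere" "log_energy V u = min_energy V"
proof -
  interpret V: bounded_potential V K by fact
  interpret Vp: bounded_potential Vp K' by fact
  have diff: "integrable \<mu> (\<lambda>x. (Vp x - V x) * (v x)\<^sup>2)"
      "log_energy Vp v = log_energy V v + (LINT x|\<mu>. (Vp x - V x) * (v x)\<^sup>2)" if "ell2 v" for v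
    using V.integrable_potential[OF that] Vp.integrable_potential[OF that] integrable_grad_sq[OF that]
    by (simp_all add: log_energy_def left_diff_distrib)
  obtain f where f: "\<And>k. f k \<in> unit_sphere" "(\<lambda>k. log_energy V (f k)) \<longlonglongrightarrow> min_energy V"
    by (rule V.minimizing_sequence) blast
  obtain r u where r: "strict_mono (r :: nat \<Rightarrow> nat)" and u: "\<And>x. (\<lambda>k. f (r k) x) \<longlonglongrightarrow> u x"
    by (rule V.unit_sphere_convergent_subsequence[OF f(1)]) (rule that)
  have min: "(\<lambda>k. log_energy V (f (r k))) \<longlonglongrightarrow> min_energy V"
    using LIMSEQ_subseq_LIMSEQ[OF f(2) r] by (simp add: o_def)
  from V.minimizing_limit_dichotomy[OF f(1) min u] show thesis
  proof (elim disjE conjE)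
    assume "u \<in> unit_sphere" "log_energy V u = min_energy V"
    then show thesis by (rule that)
  next
    assume u0: "u = (\<lambda>x. 0)"
    have "min_energy Vp \<le> min_energy V"
    proof (rule field_le_epsilon)
      fix \<epsilon> :: real
      assume e: "\<epsilon> > 0"
      obtain B where B: "finite B" "\<And>x. x \<notin> B \<Longrightarrow> Vp x - V x \<le> \<epsilon>" using decay[OF e] by blast
      \<comment> \<open>Outside \<open>B\<close> the potentials differ by at most \<open>\<epsilon>\<close>, and on the finite set \<open>B\<close> the sequence
        tends to zero.\<close>
      have bound: "min_energy Vp
          \<le> log_energy V (f (r k)) + (\<epsilon> + (\<Sum>x\<in>B. (Vp x - V x) * (f (r k) x)\<^sup>2))" for k
      proof -
        let ?v = "f (r k)"
        let ?b = "\<lambda>x. if x \<in> B then (Vp x - V x) * (?v x)\<^sup>2 else 0"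
        note v = unit_sphereD[OF f(1)[of "r k"]]
        have ib: "integrable \<mu> ?b" by (rule integrable_finite_support[OF B(1)]) auto
        have iv: "integrable \<mu> (\<lambda>x. \<epsilon> * (?v x)\<^sup>2)" using v(2) by (simp add: ell2_def)
        have pt: "(Vp x - V x) * (?v x)\<^sup>2 \<le> \<epsilon> * (?v x)\<^sup>2 + ?b x" for x
          using e B(2)[of x] by (auto intro!: mult_right_mono)
        have "(LINT x|\<mu>. (Vp x - V x) * (?v x)\<^sup>2) \<le> (LINT x|\<mu>. \<epsilon> * (?v x)\<^sup>2 + ?b x)"
          by (intro integral_mono diff(1) v(2) Bochner_Integration.integrable_add iv ib pt)
        also have "\<dots> = (LINT x|\<mu>. \<epsilon> * (?v x)\<^sup>2) + (LINT x|\<mu>. ?b x)"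
          by (intro Bochner_Integration.integral_add iv ib)
        also have "\<dots> = \<epsilon> + (\<Sum>x\<in>B. (Vp x - V x) * (?v x)\<^sup>2)"
          using v(3) by (subst integral_finite_support[OF B(1), where f = ?b]) (auto simp: mass_def)
        finally show ?thesis
          using Vp.min_energy_le[OF f(1)[of "r k"]] diff(2)[OF v(2)] by simp
      qed
      have "(\<lambda>k. log_energy V (f (r k)) + (\<epsilon> + (\<Sum>x\<in>B. (Vp x - V x) * (f (r k) x)\<^sup>2)))
          \<longlonglongrightarrow> min_energy V + (\<epsilon> + (\<Sum>x\<in>B. (Vp x - V x) * (u x)\<^sup>2))"
        by (intro tendsto_intros min u)
      from LIMSEQ_le_const[OF this, of "min_energy Vp"] bound
      show "min_energy Vp \<le> min_energy V + \<epsilon>" using u0 by auto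
    qed
    moreover have "log_energy V w \<le> log_energy Vp w"
    proof -
      have "0 \<le> (LINT x|\<mu>. (Vp x - V x) * (w x)\<^sup>2)"
        using le by (intro integral_nonneg_AE AE_I2) simp
      then show ?thesis using diff(2)[OF unit_sphereD(2)[OF w(1)]] by simp
    qed
    ultimately have "log_energy V w = min_energy V"
      using V.min_energy_le[OF w(1)] w(2) by simp
    with w(1) show thesis by (rule that)
  qed
qed

section \<open>Minimisers solve the equation\<close>

context bounded_potential
begin

text \<open>By the reverse triangle inequality no difference \<open>u y - u x\<close> grows.\<close>

lemma abs_minimizer:
  assumes u: "u \<in> unit_sphere"
  shows "(\<lambda>x. \<bar>u x\<bar>) \<in> unit_sphere" "log_energy V (\<lambda>x. \<bar>u x\<bar>) \<le> log_energy V u"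
proof -
  note uD = unit_sphereD[OF u]
  show s: "(\<lambda>x. \<bar>u x\<bar>) \<in> unit_sphere"
    using uD by (simp add: unit_sphere_def log_admissible_def ell2_def mass_def)
  have "grad_sq (\<lambda>x. \<bar>u x\<bar>) x \<le> grad_sq u x" for x
    unfolding grad_sq_def
    by (intro mult_left_mono sum_mono) (auto simp: abs_le_square_iff[symmetric] intro: abs_triangle_ineq3)
  then have "(LINT x|\<mu>. grad_sq (\<lambda>x. \<bar>u x\<bar>) x + V x * \<bar>u x\<bar>\<^sup>2) \<le> (LINT x|\<mu>. grad_sq u x + V x * (u x)\<^sup>2)"
    using integrable_grad_sq[OF uD(2)] integrable_potential[OF uD(2)]
      integrable_grad_sq[OF unit_sphereD(2)[OF s]]
    by (intro integral_mono) auto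
  then show "log_energy V (\<lambda>x. \<bar>u x\<bar>) \<le> log_energy V u" by (simp add: log_energy_def)
qed

text \<open>Changing the value of a minimiser at the single vertex \<open>z\<close> by \<open>t\<close> gives a differentiable
  function of \<open>t\<close>; the excess of the energy over its lower bound is minimal at \<open>t = 0\<close>, where the
  derivative is the Euler--Lagrange equation at \<open>z\<close>. The minimal energy is the multiplier.\<close>

lemma euler_lagrange:
  assumes us: "u \<in> unit_sphere" and min: "log_energy V u = min_energy V"
  shows "- laplacian u z + V z * u z = u z * ln ((u z)\<^sup>2) + min_energy V * u z"
proof -
  note u = unit_sphereD[OF us]
  define e where "e x = (if x = z then 1 else 0 :: real)" for x
  define v where "v t x = u x + t * e x" for t x
  have e2: "ell2 e" by (rule ell2_finite_support[of "{z}"]) (auto simp: e_def)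
  have v2: "ell2 (v t)" for t unfolding v_def[abs_def] by (intro ell2_add ell2_scale u(2) e2)
  have vz: "v t z = u z + t" and voff: "x \<noteq> z \<Longrightarrow> v t x = u x" for t x
    by (simp_all add: v_def e_def)
  have log: "integrable \<mu> (\<lambda>x. sq_log (v t x))"
      "(LINT x|\<mu>. sq_log (v t x)) = (LINT x|\<mu>. sq_log (u x)) + (sq_log (u z + t) - sq_log (u z))" for t
    using integral_modify_at[OF u(4), of z "\<lambda>x. sq_log (v t x)"] by (simp_all add: vz voff)
  have adm: "log_admissible (v t)" for t using v2 log(1) by (simp add: log_admissible_def)
  define b where "b t = 1 + ((u z + t)\<^sup>2 - (u z)\<^sup>2)" for t
  have mass_v: "mass (v t) = b t" for t
    using integral_modify_at(2)[of "\<lambda>x. (u x)\<^sup>2" z "\<lambda>x. (v t x)\<^sup>2"] u(2,3)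
    by (simp add: vz voff ell2_def mass_def b_def)
  have pot: "(LINT x|\<mu>. V x * (v t x)\<^sup>2)
      = (LINT x|\<mu>. V x * (u x)\<^sup>2) + (V z * (u z + t)\<^sup>2 - V z * (u z)\<^sup>2)" for t
    using integral_modify_at(2)[OF integrable_potential[OF u(2)], of z "\<lambda>x. V x * (v t x)\<^sup>2"]
    by (simp add: vz voff)
  have at_z: "(LINT x|\<mu>. e x * g x) = g z" for g
    by (subst integral_finite_support[of "{z}"]) (auto simp: e_def)
  have lap: "(LINT x|\<mu>. v t x * laplacian (v t) x)
      = (LINT x|\<mu>. u x * laplacian u x) + 2 * t * laplacian u z + t\<^sup>2 * laplacian e z" for t
  proof -
    have "laplacian (v t) x = laplacian u x + t * laplacian e x" for x
      by (simp add: laplacian_def v_def sum_distrib_left algebra_simps flip: sum.distrib)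
    then have "v t x * laplacian (v t) x = u x * laplacian u x + t * (u x * laplacian e x)
        + t * (e x * laplacian u x) + t\<^sup>2 * (e x * laplacian e x)" for x
      by (simp add: v_def algebra_simps power2_eq_square)
    then have "(LINT x|\<mu>. v t x * laplacian (v t) x) = (LINT x|\<mu>. u x * laplacian u x)
        + t * (LINT x|\<mu>. u x * laplacian e x) + t * (LINT x|\<mu>. e x * laplacian u x)
        + t\<^sup>2 * (LINT x|\<mu>. e x * laplacian e x)"
      using u(2) e2 by (simp add: integrable_mult_ell2 ell2_laplacian)
    then show ?thesis unfolding green_symmetric[OF u(2) e2] at_z by simp
  qed
  define \<phi> where "\<phi> t = log_energy V u + V z * (u z + t)\<^sup>2 - V z * (u z)\<^sup>2
      - 2 * t * laplacian u z - t\<^sup>2 * laplacian e z - sq_log (u z + t) + sq_log (u z)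
      - (b t * min_energy V - b t * ln (b t))" for t
  have "\<phi> t = log_energy V (v t) - (mass (v t) * min_energy V - mass (v t) * ln (mass (v t)))" for t
    unfolding \<phi>_def mass_v log_energy_green[OF v2] log_energy_green[OF u(2)] pot lap log(2) by simp
  then have "\<phi> t \<ge> 0" for t using log_energy_lower_bound[OF adm, of t] by simp
  moreover have "\<phi> 0 = 0" using min by (simp add: \<phi>_def b_def)
  ultimately have locmin: "\<forall>t. \<bar>0 - t\<bar> < 1 \<longrightarrow> \<phi> 0 \<le> \<phi> t" by simp
  have db: "(b has_real_derivative 2 * u z) (at 0)"
    unfolding b_def by (auto intro!: derivative_eq_intros)
  have b0: "b 0 = 1" by (simp add: b_def)
  have "((\<lambda>t. b t * ln (b t)) has_real_derivative 2 * u z) (at 0)"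
    by (rule derivative_eq_intros db refl | simp add: b0)+
  moreover have "((\<lambda>t. sq_log (u z + t)) has_real_derivative 2 * u z * ln ((u z)\<^sup>2) + 2 * u z) (at 0)"
    using DERIV_sq_log[of "u z"] DERIV_shift[of sq_log _ 0 "u z"] by (simp add: add.commute)
  ultimately have "(\<phi> has_real_derivative 2 * (V z * u z) - 2 * laplacian u z
      - (2 * u z * ln ((u z)\<^sup>2) + 2 * u z) - (2 * u z * min_energy V - 2 * u z)) (at 0)"
    unfolding \<phi>_def by (auto intro!: derivative_eq_intros db simp: b0)
  from DERIV_local_min[OF this _ locmin] show ?thesis by (simp add: algebra_simps)
qed

text \<open>At a zero of a nonnegative minimiser the Euler--Lagrange equation says that the Laplacian, a
  sum of nonnegative values at the neighbours, vanishes; so the zeros spread over the lattice.\<close>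

lemma minimizer_pos:
  assumes us: "u \<in> unit_sphere" and min: "log_energy V u = min_energy V" and nn: "\<And>x. u x \<ge> 0"
  shows "u x > 0"
proof (rule ccontr)
  assume "\<not> u x > 0"
  then have x: "u x = 0" using nn[of x] by simp
  have spread: "u y = 0" if "u z = 0" "y \<sim>\<^sub>Z z" for y z
  proof -
    have "(\<Sum>y | y \<sim>\<^sub>Z z. u y) = 0"
      using euler_lagrange[OF us min, of z] that(1) by (simp add: laplacian_def)
    then have "\<forall>y\<in>{y. y \<sim>\<^sub>Z z}. u y = 0"
      using nn by (subst (asm) sum_nonneg_eq_0_iff[OF finite_neighbours]) auto
    then show ?thesis using that(2) by simp
  qed
  have axis: "(axis i 1 :: int ^ 'n) \<in> steps" for i
    by (simp add: steps_def adj_def axis_def if_distrib cong: if_cong)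
  have "u (x + 1 *s k) = 0" for k
  proof (rule lattice_induct)
    fix y i
    assume y: "u y = 0"
    show "u (y + 1 *s axis i 1) = 0" "u (y - 1 *s axis i 1) = 0"
      using axis[of i] by (auto intro!: spread[OF y] simp: adj_iff_steps)
  qed (rule x)
  from this[of "_ - x"] have "u = (\<lambda>x. 0)" by auto
  then show False using unit_sphereD(3)[OF us] by (simp add: mass_def)
qed

end

section \<open>The function spaces and the functional\<close>

lemma integral_grad_sq_le:
  fixes u :: "int ^ 'n \<Rightarrow> real"
  assumes u: "ell2 u"
  shows "(LINT x|\<mu>. grad_sq u x + (u x)\<^sup>2) \<le> (2 * card (steps :: (int ^ 'n) set) + 1) * mass u"
proof -
  have sq: "integrable \<mu> (\<lambda>x. (u x)\<^sup>2)" using u by (simp add: ell2_def)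
  have sh: "integrable \<mu> (\<lambda>x. (u (x + d))\<^sup>2)" for d
    using integrable_shift[of "\<lambda>x. (u x)\<^sup>2" d] sq by simp
  have isum: "integrable \<mu> (\<lambda>x. \<Sum>d\<in>steps. (u (x + d))\<^sup>2 + (u x)\<^sup>2)"
    by (intro Bochner_Integration.integrable_sum Bochner_Integration.integrable_add sh sq)
  have pt: "grad_sq u x \<le> (\<Sum>d\<in>steps. (u (x + d))\<^sup>2 + (u x)\<^sup>2)" for x
  proof -
    have "1/2 * (a - b)\<^sup>2 \<le> a\<^sup>2 + b\<^sup>2" for a b :: real
      using zero_le_power2[of "a + b"] by (simp add: power2_sum power2_diff)
    then show ?thesis unfolding grad_sq_steps sum_distrib_left by (intro sum_mono)
  qed
  have "(LINT x|\<mu>. grad_sq u x + (u x)\<^sup>2) \<le> (LINT x|\<mu>. (\<Sum>d\<in>steps. (u (x + d))\<^sup>2 + (u x)\<^sup>2) + (u x)\<^sup>2)"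
    using pt by (intro integral_mono Bochner_Integration.integrable_add integrable_grad_sq u sq isum) auto
  also have "\<dots> = (LINT x|\<mu>. (\<Sum>d\<in>steps. (u (x + d))\<^sup>2 + (u x)\<^sup>2)) + mass u"
    unfolding mass_def by (rule Bochner_Integration.integral_add[OF isum sq])
  also have "(LINT x|\<mu>. (\<Sum>d\<in>steps. (u (x + d))\<^sup>2 + (u x)\<^sup>2))
      = (\<Sum>d\<in>steps. LINT x|\<mu>. (u (x + d))\<^sup>2 + (u x)\<^sup>2)"
    by (intro Bochner_Integration.integral_sum Bochner_Integration.integrable_add sh sq)
  also have "\<dots> = (\<Sum>d\<in>(steps :: (int ^ 'n) set). 2 * mass u)"
    using sh sq integral_shift[of "\<lambda>x. (u x)\<^sup>2"] by (simp add: mass_def)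
  finally show ?thesis by (simp add: algebra_simps)
qed

text \<open>Since every vertex has the same finite degree, the norm of \<open>H1\<close> is equivalent to the \<open>\<ell>\<^sup>2\<close>
  norm, for which truncation to balls converges.\<close>

lemma H1_iff_ell2: "u \<in> H1 \<longleftrightarrow> ell2 u"
proof
  assume "u \<in> H1"
  then have "integrable \<mu> (\<lambda>x. grad_sq u x + (u x)\<^sup>2)" by (simp add: H1_def)
  then show "ell2 u" unfolding ell2_def by (rule integrable_dominated) simp
next
  fix u :: "int ^ 'a \<Rightarrow> real"
  assume u: "ell2 u"
  define \<phi> where "\<phi> r x = (if x \<in> l1_ball r then u x else 0)" for r x
  have supp: "finite {x. \<phi> r x \<noteq> 0}" for r
    by (rule finite_subset[OF _ finite_l1_ball[of r]]) (auto simp: \<phi>_def)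
  have \<phi>2: "ell2 (\<phi> r)" for r by (rule ell2_dominated[OF u]) (simp add: \<phi>_def)
  let ?C = "real (2 * card (steps :: (int ^ 'a) set) + 1)"
  let ?m = "\<lambda>r. mass u - (\<Sum>x\<in>l1_ball r. (u x)\<^sup>2)"
  have tail: "mass (\<lambda>x. u x - \<phi> r x) = ?m r" for r
  proof -
    have "mass u = (LINT x|\<mu>. (u x - \<phi> r x)\<^sup>2 + (\<phi> r x)\<^sup>2)"
      unfolding mass_def by (rule Bochner_Integration.integral_cong) (auto simp: \<phi>_def)
    also have "\<dots> = mass (\<lambda>x. u x - \<phi> r x) + mass (\<phi> r)"
      using ell2_diff[OF u \<phi>2[of r]] \<phi>2[of r] by (simp add: mass_def ell2_def)
    also have "mass (\<phi> r) = (\<Sum>x\<in>l1_ball r. (u x)\<^sup>2)"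
      unfolding mass_def by (subst integral_finite_support[OF finite_l1_ball[of r]]) (auto simp: \<phi>_def)
    finally show ?thesis by simp
  qed
  have "(\<lambda>r. sqrt (?C * ?m r)) \<longlonglongrightarrow> sqrt (?C * (mass u - mass u))"
    by (intro tendsto_intros mass_exhaustion u)
  then have lim: "(\<lambda>r. sqrt (?C * ?m r)) \<longlonglongrightarrow> 0" by simp
  have "(\<lambda>r. h1_norm (\<lambda>x. u x - \<phi> r x)) \<longlonglongrightarrow> 0"
  proof (rule tendsto_sandwich[OF _ _ tendsto_const lim])
    have "h1_norm (\<lambda>x. u x - \<phi> r x) \<le> sqrt (?C * ?m r)" for r
      using integral_grad_sq_le[OF ell2_diff[OF u \<phi>2[of r]]] unfolding h1_norm_def tail
      by (intro real_sqrt_le_mono) simp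
    then show "\<forall>\<^sub>F r in sequentially. h1_norm (\<lambda>x. u x - \<phi> r x) \<le> sqrt (?C * ?m r)"
      by (intro always_eventually allI)
    show "\<forall>\<^sub>F r in sequentially. 0 \<le> h1_norm (\<lambda>x. u x - \<phi> r x)"
      by (intro always_eventually allI) (simp add: h1_norm_def integral_nonneg_AE)
  qed
  then show "u \<in> H1"
    using supp integrable_grad_sq[OF u] u unfolding H1_def ell2_def by auto
qed

lemma ext_integral_integrable:
  assumes f: "integrable \<mu> f"
  shows "ext_integral f = ereal (LINT x|\<mu>. f x)"
proof -
  have "(\<integral>\<^sup>+x. ennreal (f x) \<partial>\<mu>) < top" "(\<integral>\<^sup>+x. ennreal (- f x) \<partial>\<mu>) < top"
    using f by (auto simp: real_integrable_def top.not_eq_extremum)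
  then have "enn2ereal (\<integral>\<^sup>+x. ennreal (f x) \<partial>\<mu>) = ereal (enn2real (\<integral>\<^sup>+x. ennreal (f x) \<partial>\<mu>))"
    "enn2ereal (\<integral>\<^sup>+x. ennreal (- f x) \<partial>\<mu>) = ereal (enn2real (\<integral>\<^sup>+x. ennreal (- f x) \<partial>\<mu>))"
    by (metis enn2ereal_ennreal enn2real_nonneg ennreal_enn2real)+
  then show ?thesis by (simp add: ext_integral_def real_lebesgue_integral_def[OF f])
qed

text \<open>A square-summable function is bounded, so the positive part of \<open>sq_log \<circ> u\<close> is dominated by a
  multiple of \<open>u\<^sup>2\<close>, and only the negative part can have an infinite sum.\<close>

lemma ext_integral_not_integrable:
  assumes u: "ell2 u" and ni: "\<not> integrable \<mu> (\<lambda>x. sq_log (u x))"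
  shows "ext_integral (\<lambda>x. sq_log (u x)) = - \<infinity>"
proof -
  have i: "integrable \<mu> (\<lambda>x. mass u * (u x)\<^sup>2)" using u by (simp add: ell2_def)
  have "(\<integral>\<^sup>+x. ennreal (sq_log (u x)) \<partial>\<mu>) \<le> (\<integral>\<^sup>+x. ennreal (mass u * (u x)\<^sup>2) \<partial>\<mu>)"
    by (intro nn_integral_mono ennreal_leI order_trans[OF sq_log_le] mult_right_mono sq_le_mass u) simp
  also have "\<dots> = ennreal (LINT x|\<mu>. mass u * (u x)\<^sup>2)"
    by (rule nn_integral_eq_integral[OF i]) simp
  finally have fin: "(\<integral>\<^sup>+x. ennreal (sq_log (u x)) \<partial>\<mu>) < top"
    by (rule le_less_trans) simp
  then have "(\<integral>\<^sup>+x. ennreal (- sq_log (u x)) \<partial>\<mu>) = top"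
    using ni by (auto simp: real_integrable_def)
  moreover obtain p where "enn2ereal (\<integral>\<^sup>+x. ennreal (sq_log (u x)) \<partial>\<mu>) = ereal p"
    using fin by (metis enn2ereal_ennreal enn2real_nonneg ennreal_enn2real)
  ultimately show ?thesis by (simp add: ext_integral_def top_ereal_def)
qed

context bounded_potential
begin

lemma
  assumes "log_admissible u"
  shows J_eq: "J V u = ereal (1/2 * (log_energy V u + mass u))"
    and dom_J_admissible: "u \<in> dom_J V"
proof -
  note u = log_admissibleD[OF assms]
  have eq: "grad_sq u x + (V x + 1) * (u x)\<^sup>2 = (grad_sq u x + V x * (u x)\<^sup>2) + (u x)\<^sup>2" for x
    by (simp add: algebra_simps)
  have i: "integrable \<mu> (\<lambda>x. grad_sq u x + V x * (u x)\<^sup>2)" "integrable \<mu> (\<lambda>x. (u x)\<^sup>2)"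
    using integrable_grad_sq[OF u(1)] integrable_potential[OF u(1)] u(1) by (simp_all add: ell2_def)
  have "(LINT x|\<mu>. grad_sq u x + (V x + 1) * (u x)\<^sup>2)
      = (LINT x|\<mu>. grad_sq u x + V x * (u x)\<^sup>2) + mass u"
    unfolding eq mass_def by (rule Bochner_Integration.integral_add[OF i])
  then show J: "J V u = ereal (1/2 * (log_energy V u + mass u))"
    unfolding J_def sq_log_def[symmetric] ext_integral_integrable[OF u(2)] log_energy_def
    by (simp add: field_simps)
  have "integrable \<mu> (\<lambda>x. (V x + 1) * (u x)\<^sup>2)"
    using integrable_potential[OF u(1)] i(2) by (simp add: distrib_right)
  then show "u \<in> dom_J V" using J u(1) by (simp add: dom_J_def X_space_def H1_iff_ell2)
qed

lemma dom_J_iff: "u \<in> dom_J V \<longleftrightarrow> log_admissible u"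
proof
  assume u: "u \<in> dom_J V"
  then have u2: "ell2 u" by (simp add: dom_J_def X_space_def H1_iff_ell2)
  show "log_admissible u"
  proof (rule ccontr)
    assume "\<not> log_admissible u"
    then have "\<not> integrable \<mu> (\<lambda>x. sq_log (u x))" using u2 by (simp add: log_admissible_def)
    then have "J V u = \<infinity>"
      unfolding J_def sq_log_def[symmetric] using ext_integral_not_integrable[OF u2] by simp
    then show False using u by (simp add: dom_J_def)
  qed
qed (rule dom_J_admissible)

lemma nehari_iff: "u \<in> nehari V \<longleftrightarrow> log_admissible u \<and> u \<noteq> (\<lambda>x. 0) \<and> log_energy V u = 0"
  unfolding nehari_def sq_log_def[symmetric]
  by (auto simp: dom_J_iff log_energy_def ext_integral_integrable log_admissibleD(2))

section \<open>Ground states\<close>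

text \<open>On the Nehari manifold \<open>J\<close> is half the mass, and the lower bound for the energy forces the mass
  to be at least \<open>exp m\<close> with \<open>m\<close> the minimal energy on the unit sphere. The multiple of mass \<open>exp m\<close>
  of a normalised minimiser has energy zero, and for it the multiplier \<open>m\<close> in the Euler--Lagrange
  equation is absorbed into the logarithm.\<close>

proposition minimizer_gives_ground_state:
  assumes us: "u \<in> unit_sphere" and min: "log_energy V u = min_energy V" and pos: "\<And>x. u x > 0"
  obtains v where "ground_state V v" "\<And>x. v x > 0"
proof
  define m where "m = min_energy V"
  define s where "s = exp (m / 2)"
  have s: "s > 0" and s2: "s\<^sup>2 = exp m" by (simp_all add: s_def power2_eq_square flip: exp_add)
  let ?v = "\<lambda>x. s * u x"
  note u = unit_sphereD[OF us]
  have adm: "log_admissible ?v" by (rule log_energy_scale(1)[OF u(1)])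
  have mass_v: "mass ?v = exp m" by (simp add: mass_scale u(3) s2)
  have energy_v: "log_energy V ?v = 0"
    by (simp add: log_energy_scale(2)[OF u(1)] min u(3) sq_log_def s2 m_def)
  show vpos: "s * u x > 0" for x using s pos[of x] by simp
  then have nz: "?v \<noteq> (\<lambda>x. 0)" by (metis less_irrefl)
  have "- laplacian ?v x + V x * ?v x = ?v x * ln ((?v x)\<^sup>2)" for x
  proof -
    have "laplacian ?v x = s * laplacian u x"
      by (simp add: laplacian_def sum_distrib_left right_diff_distrib)
    then have "- laplacian ?v x + V x * ?v x = s * (- laplacian u x + V x * u x)"
      by (simp add: algebra_simps)
    also have "\<dots> = s * u x * (ln ((u x)\<^sup>2) + m)"
      unfolding euler_lagrange[OF us min] m_def by (simp add: algebra_simps)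
    also have "ln ((u x)\<^sup>2) + m = ln ((?v x)\<^sup>2)"
      using pos[of x] by (simp add: power_mult_distrib s2 ln_mult_pos)
    finally show ?thesis .
  qed
  then have sol: "solution V ?v" using adm by (simp add: solution_def dom_J_iff)
  have Jv: "J V ?v = ereal (1/2 * exp m)" by (simp add: J_eq[OF adm] energy_v mass_v)
  have "J V ?v = (INF w\<in>nehari V. J V w)"
  proof (rule antisym)
    show "J V ?v \<le> (INF w\<in>nehari V. J V w)"
    proof (rule INF_greatest)
      fix w
      assume "w \<in> nehari V"
      then have w: "log_admissible w" "w \<noteq> (\<lambda>x. 0)" "log_energy V w = 0" by (simp_all add: nehari_iff)
      have a: "mass w > 0"
        using w(2) mass_eq_0_iff[OF log_admissibleD(1)[OF w(1)]] mass_nonneg[of w] by linarith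
      have "mass w * (m - ln (mass w)) \<le> 0"
        using log_energy_lower_bound[OF w(1)] by (simp add: w(3) m_def right_diff_distrib)
      then have "m \<le> ln (mass w)" using a by (simp add: mult_le_0_iff)
      then have "exp m \<le> mass w" using a by (simp add: ln_ge_iff)
      then show "J V ?v \<le> J V w" by (simp add: Jv J_eq[OF w(1)] w(3))
    qed
    show "(INF w\<in>nehari V. J V w) \<le> J V ?v"
      by (rule INF_lower) (use adm nz energy_v in \<open>simp add: nehari_iff\<close>)
  qed
  then show "ground_state V ?v" using sol nz by (simp add: ground_state_def)
qed

end

theorem theorem1p3:
  fixes V :: "int ^ 'n \<Rightarrow> real"
  assumes "\<exists>(T::nat) (Vp :: int ^ 'n \<Rightarrow> real). T > 0 \<and> periodic T Vp \<and>
      - 1 < (INF x. ereal (V x)) \<and>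
      (\<forall>x. V x \<le> Vp x) \<and>
      ((\<lambda>x. \<bar>V x - Vp x\<bar>) \<longlongrightarrow> 0) (filtercomap l1_norm at_top)"
  shows "\<exists>u. ground_state V u \<and> ((\<forall>x. u x > 0) \<or> (\<forall>x. u x < 0))"
proof -
  obtain T Vp where T: "T > 0" and per: "periodic T Vp" and inf: "- 1 < (INF x. ereal (V x))"
    and le: "\<And>x. V x \<le> Vp x"
    and lim: "((\<lambda>x. \<bar>V x - Vp x\<bar>) \<longlongrightarrow> 0) (filtercomap l1_norm at_top)"
    using assms by blast
  have lower: "- 1 \<le> V x" for x
  proof -
    have "- 1 < ereal (V x)" using inf INF_lower[of x UNIV "\<lambda>x. ereal (V x)"] by (simp add: less_le_trans)
    then show ?thesis by (simp add: one_ereal_def)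
  qed
  define K where "K = Max (Vp ` period_cell T)"
  have upper: "Vp x \<le> K" for x
  proof -
    obtain y k where y: "y \<in> period_cell T" "x = y + int T *s k"
      by (rule translate_into_period_cell[OF T])
    then show ?thesis
      by (simp add: periodic_translate[OF per] K_def finite_period_cell)
  qed
  interpret V: bounded_potential V K
    by unfold_locales (use lower le upper order_trans in blast)+
  interpret Vp: bounded_potential Vp K
    by unfold_locales (use lower le upper order_trans in blast)+
  have decay: "\<exists>B. finite B \<and> (\<forall>x. x \<notin> B \<longrightarrow> Vp x - V x \<le> \<epsilon>)" if "\<epsilon> > 0" for \<epsilon>
  proof -
    have "\<forall>\<^sub>F x in filtercomap l1_norm at_top. \<bar>V x - Vp x\<bar> < \<epsilon>"
      using order_tendstoD(2)[OF lim that] .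
    then obtain R where R: "\<And>x. l1_norm x \<ge> R \<Longrightarrow> \<bar>V x - Vp x\<bar> < \<epsilon>"
      by (auto simp: eventually_filtercomap eventually_at_top_linorder)
    have "Vp x - V x \<le> \<epsilon>" if "x \<notin> l1_ball (nat R)" for x
    proof -
      have "R \<le> l1_norm x" using that by (auto simp: l1_ball_def split: if_splits)
      then show ?thesis using R[of x] by linarith
    qed
    then show ?thesis using finite_l1_ball by blast
  qed
  obtain w where w: "w \<in> unit_sphere" "log_energy Vp w = min_energy Vp"
    by (rule Vp.periodic_minimizer[OF per T])
  obtain u where u: "u \<in> unit_sphere" "log_energy V u = min_energy V"
    by (rule minimizer_below_potential[OF V.bounded_potential_axioms Vp.bounded_potential_axioms le decay w])
  let ?u = "\<lambda>x. \<bar>u x\<bar>"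
  have abs: "?u \<in> unit_sphere" "log_energy V ?u = min_energy V"
    using V.abs_minimizer[OF u(1)] V.min_energy_le[OF V.abs_minimizer(1)[OF u(1)]] u(2) by simp_all
  have "?u x > 0" for x
    by (rule V.minimizer_pos[OF abs]) simp
  from V.minimizer_gives_ground_state[OF abs this]
  obtain v where "ground_state V v" "\<And>x. v x > 0" by metis
  then show ?thesis by blast
qed

end
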